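(* Let $V=\oplus_{q\in\frac12\mathbb{Z}}V_{(q)}$ be a vertex operator superalgebra such that $V_{(\frac32)}+V_{(2)}$ strongly generates $V$. Then $V$ admits a symmetric invariant bilinear form $\langle\cdot,\cdot\rangle$ which is uniquely determined by $\langle\mathbf 1,\mathbf 1\rangle=1$. Furthermore, the kernel of $\langle\cdot,\cdot\rangle$ coincides with the unique maximal ideal $I$ of $V$ (with $\mathbf 1\notin I$). On the other hand, $V$ is simple if and only if the bilinear form $\langle\cdot,\cdot\rangle$ is non-degenerate.
   Context: A vertex operator superalgebra is $(V,Y,\mathbf 1,\omega)$ with $V=\oplus_{q\in\frac12\mathbb{Z}}V_{(q)}$ a complex vector space with parity decomposition $V^{\bar0}=\oplus_{n\in\mathbb{Z}}V_{(n)}$, $V^{\bar1}=\oplus_{n\in\mathbb{Z}}V_{(n+\frac12)}$, a linear map $Y(v,z)=\sum_n v_nz^{-n-1}\in(\mathrm{End}\,V)[[z,z^{-1}]]$, and even vectors $\mathbf 1,\omega$, such that: $u_nv\in V^{\alpha+\beta}$ for $u\in V^\alpha,v\in V^\beta$ and $u_nv=0$ for $n$ large; for parity-homogeneous $u,v$ and $m,n,k\in\mathbb{Z}$, $\sum_{i\ge0}(-1)^i\binom mi(u_{m+k-i}v_{n+i}-(-1)^{|u||v|}(-1)^mv_{m+n-i}u_{k+i})=\sum_{i\ge0}\binom ki(u_{m+i}v)_{n+k-i}$ (Jacobi identity); $\mathbf 1_mv=\delta_{m,-1}v$, $v_{-1}\mathbf 1=v$, $v_n\mathbf 1=0$ for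 $n\ge0$; $L(n)=\omega_{n+1}$ satisfy $[L(m),L(n)]=(m-n)L(m+n)+\frac{m^3-m}{12}\delta_{m+n,0}c_V$ for some $c_V\in\mathbb{C}$; $Y(L(-1)v,z)=\frac{d}{dz}Y(v,z)$; $V_{(q)}=\{v: L(0)v=qv\}$; $\dim V_{(q)}<\infty$ for all $q$ and $V_{(q)}=0$ for $q$ sufficiently negative. $V$ is strongly generated by a subset $T$ if $V$ is spanned by $\mathbf 1$ and the vectors $a^{(1)}_{-n_1}\cdots a^{(r)}_{-n_r}\mathbf 1$ with $r\ge1$, $a^{(i)}\in T$, $n_i$ positive integers. A bilinear form on $V$ is said to be invariant if $\langle Y(u,z)v,w\rangle=\langle v,Y(e^{zL(1)}z^{-2L(0)}e^{\pi iL(0)}u,z^{-1})w\rangle$ for $u,v,w\in V$, where $i=\sqrt{-1}$ and $e^{\pi iL(0)}v=e^{q\pi i}v$, $z^{-2L(0)}v=z^{-2q}v$ for $v\in V_{(q)}$, $q\in\frac12\mathbb{Z}$. The kernel of a symmetric form is $\{v:\langle v,V\rangle=0\}$. An ideal is a subspace $I$ with $v_nx\in I$ and $x_nv\in I$ for all $x\in I$, $v\in V$, $n\in\mathbb{Z}$; $V$ is simple if its only ideals are $0$ and $V$; "maximal ideal" means maximal proper ideal.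
   Formalization: Invariance carries the extra sign (-1)^{|u||v|} for parity-homogeneous u, v; as printed, without it, the Neveu-Schwarz algebra with nonzero central charge has no invariant form with <1,1>=1. V is also assumed nonzero. *)

theory Defs
  imports Complex_Main "HOL-Library.Groups_Big_Fun"
begin

text \<open>
  A family \<open>W\<close> of subspaces indexed by \<open>I\<close>: a decomposition of \<open>v\<close> is a finitely supported
  choice of components \<open>f i \<in> W i\<close> with sum \<open>v\<close>.
\<close>

definition decomposition :: "'i set \<Rightarrow> ('i \<Rightarrow> 'v::ab_group_add set) \<Rightarrow> 'v \<Rightarrow> ('i \<Rightarrow> 'v) \<Rightarrow> bool" where
  "decomposition I W v f \<longleftrightarrow>
     (\<forall>i\<in>I. f i \<in> W i) \<and> (\<forall>i. i \<notin> I \<longrightarrow> f i = 0) \<and> finite {i. f i \<noteq> 0} \<and> v = (\<Sum>i | f i \<noteq> 0. f i)"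

definition half_ints :: "real set" where
  "half_ints = {q. 2 * q \<in> \<int>}"

text \<open>
  \<open>mode v n w\<close> is $v_n w$, i.e. $Y(v,z)w = \sum_n (v_n w) z^{-n-1}$; \<open>vac\<close> is the vacuum vector and
  \<open>om\<close> the conformal vector. All possibly infinite sums below have only finitely many nonzero
  terms (in a vertex operator superalgebra) and are written with \<open>Sum_any\<close>.
\<close>

locale vosa_data = vector_space scale
  for scale :: "complex \<Rightarrow> 'v::ab_group_add \<Rightarrow> 'v" (infixr "*s" 75) +
  fixes mode :: "'v \<Rightarrow> int \<Rightarrow> 'v \<Rightarrow> 'v"
    and vac :: 'v
    and om :: 'v
begin

definition L :: "int \<Rightarrow> 'v \<Rightarrow> 'v" where
  "L n v = mode om (n + 1) v"

definition wt_space :: "real \<Rightarrow> 'v set" where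
  "wt_space q = {v. L 0 v = complex_of_real q *s v}"

text \<open>
  The homogeneous component of weight \<open>q\<close>.
\<close>
definition wt_component :: "real \<Rightarrow> 'v \<Rightarrow> 'v" where
  "wt_component q v = (THE f. decomposition half_ints wt_space v f) q"

text \<open>
  \<open>parity_space a\<close> depends only on \<open>a\<close> modulo 2: it is $V^{\bar 0}$ for even \<open>a\<close> and $V^{\bar 1}$ for
  odd \<open>a\<close>.
\<close>
definition parity_space :: "nat \<Rightarrow> 'v set" where
  "parity_space a = span (\<Union>n::int. wt_space (of_int n + of_nat a / 2))"

definition strongly_generated_by :: "'v set \<Rightarrow> bool" where
  "strongly_generated_by T \<longleftrightarrow>
     span (insert vac {foldr (\<lambda>(a, n). mode a (- n)) xs vac | xs :: ('v \<times> int) list.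
             xs \<noteq> [] \<and> (\<forall>(a, n) \<in> set xs. a \<in> T \<and> 0 < n)}) = UNIV"

definition is_ideal :: "'v set \<Rightarrow> bool" where
  "is_ideal I \<longleftrightarrow> subspace I \<and> (\<forall>x\<in>I. \<forall>v n. mode v n x \<in> I \<and> mode x n v \<in> I)"

definition is_maximal_ideal :: "'v set \<Rightarrow> bool" where
  "is_maximal_ideal I \<longleftrightarrow> is_ideal I \<and> I \<noteq> UNIV \<and>
     (\<forall>J. is_ideal J \<longrightarrow> J \<noteq> UNIV \<longrightarrow> I \<subseteq> J \<longrightarrow> J = I)"

definition is_simple :: bool where
  "is_simple \<longleftrightarrow> (\<forall>I. is_ideal I \<longrightarrow> I = {0} \<or> I = UNIV)"

definition bilinear_form :: "('v \<Rightarrow> 'v \<Rightarrow> complex) \<Rightarrow> bool" where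
  "bilinear_form B \<longleftrightarrow>
     (\<forall>v. Vector_Spaces.linear scale (*) (\<lambda>w. B v w)) \<and>
     (\<forall>w. Vector_Spaces.linear scale (*) (\<lambda>v. B v w))"

text \<open>
  \<open>adj_coeff u d\<close> is the coefficient of $z^d$ in $e^{zL(1)} z^{-2L(0)} e^{\pi i L(0)} u$.
  The weight \<open>q\<close> component of \<open>u\<close> contributes
  $\sum_j \frac{1}{j!} e^{\pi i q} z^{j-2q} L(1)^j u_q$, so $q = (j-d)/2$ in the \<open>j\<close>-th term.
\<close>
definition adj_coeff :: "'v \<Rightarrow> int \<Rightarrow> 'v" where
  "adj_coeff u d = Sum_any (\<lambda>j::nat.
     let q = of_int (int j - d) / 2 :: real in
     (exp (of_real pi * \<i> * of_real q) / fact j) *s ((L 1 ^^ j) (wt_component q u)))"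

text \<open>
  \<open>adj_mode u n w\<close> is the coefficient of $z^{-n-1}$ in
  $Y(e^{zL(1)} z^{-2L(0)} e^{\pi i L(0)} u, z^{-1}) w$: since $Y(x,z^{-1})w = \sum_m (x_m w) z^{m+1}$,
  the term $z^d$ of its argument contributes with $d + m + 1 = -n - 1$.
\<close>
definition adj_mode :: "'v \<Rightarrow> int \<Rightarrow> 'v \<Rightarrow> 'v" where
  "adj_mode u n w = Sum_any (\<lambda>d::int. mode (adj_coeff u d) (- n - 2 - d) w)"

text \<open>
  Invariance, read with the Koszul sign $(-1)^{|u||v|}$ for moving \<open>u\<close> past \<open>v\<close>:
  \[ \langle Y(u,z)v,w\rangle
     = (-1)^{|u||v|} \langle v, Y(e^{zL(1)} z^{-2L(0)} e^{\pi i L(0)} u, z^{-1}) w\rangle . \]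
  The sign is 1 unless \<open>u\<close> and \<open>v\<close> are both odd. There it cannot be omitted: without it, an odd
  \<open>u\<close> of weight $\frac32$ with $u_2 u = c \mathbf 1$ would satisfy both
  $c \langle \mathbf 1,\mathbf 1\rangle = -i \langle u,u\rangle$ and
  $\langle u,u\rangle = -ic \langle \mathbf 1,\mathbf 1\rangle$, hence
  $c \langle \mathbf 1,\mathbf 1\rangle = 0$, and the Neveu-Schwarz algebras of nonzero central
  charge would carry no form with $\langle \mathbf 1,\mathbf 1\rangle = 1$.
\<close>
definition invariant_form :: "('v \<Rightarrow> 'v \<Rightarrow> complex) \<Rightarrow> bool" where
  "invariant_form B \<longleftrightarrow>
     (\<forall>a b u v w n. u \<in> parity_space a \<longrightarrow> v \<in> parity_space b \<longrightarrow>
        B (mode u n v) w = (- 1) ^ (a * b) * B v (adj_mode u n w))"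

definition symmetric_form :: "('v \<Rightarrow> 'v \<Rightarrow> complex) \<Rightarrow> bool" where
  "symmetric_form B \<longleftrightarrow> (\<forall>v w. B v w = B w v)"

definition form_kernel :: "('v \<Rightarrow> 'v \<Rightarrow> complex) \<Rightarrow> 'v set" where
  "form_kernel B = {v. \<forall>w. B v w = 0}"

definition nondegenerate_form :: "('v \<Rightarrow> 'v \<Rightarrow> complex) \<Rightarrow> bool" where
  "nondegenerate_form B \<longleftrightarrow> form_kernel B = {0}"

definition normalized_form :: "('v \<Rightarrow> 'v \<Rightarrow> complex) \<Rightarrow> bool" where
  "normalized_form B \<longleftrightarrow>
     bilinear_form B \<and> symmetric_form B \<and> invariant_form B \<and> B vac vac = 1"

end

text \<open>
  The grading is not separate data, since $V_{(q)}$ is required to be the \<open>q\<close>-eigenspace of $L(0)$.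
\<close>

locale vertex_operator_superalgebra = vosa_data scale mode vac om
  for scale :: "complex \<Rightarrow> 'v::ab_group_add \<Rightarrow> 'v" (infixr "*s" 75)
    and mode :: "'v \<Rightarrow> int \<Rightarrow> 'v \<Rightarrow> 'v"
    and vac :: 'v
    and om :: 'v +
  assumes grading: "\<And>v. \<exists>!f. decomposition half_ints wt_space v f"
    and finite_dim: "\<And>q. q \<in> half_ints \<Longrightarrow> \<exists>S. finite S \<and> wt_space q \<subseteq> span S"
    and bounded_below: "\<exists>N. \<forall>q\<in>half_ints. q < N \<longrightarrow> wt_space q = {0}"
    and mode_linear: "\<And>v n. Vector_Spaces.linear scale scale (\<lambda>w. mode v n w)"
    and Y_linear: "\<And>n w. Vector_Spaces.linear scale scale (\<lambda>v. mode v n w)"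
    and vac_even: "vac \<in> parity_space 0"
    and om_even: "om \<in> parity_space 0"
    and mode_parity: "\<And>a b u v n. u \<in> parity_space a \<Longrightarrow> v \<in> parity_space b \<Longrightarrow>
          mode u n v \<in> parity_space (a + b)"
    and truncation: "\<And>u v. \<exists>N. \<forall>n\<ge>N. mode u n v = 0"
    and jacobi: "\<And>a b u v w m n k. u \<in> parity_space a \<Longrightarrow> v \<in> parity_space b \<Longrightarrow>
          Sum_any (\<lambda>i::nat. ((- 1) ^ i * (of_int m gchoose i)) *s
             (mode u (m + k - int i) (mode v (n + int i) w)
              - ((- 1) ^ (a * b) * (- 1) powi m) *s
                  mode v (m + n - int i) (mode u (k + int i) w)))
          = Sum_any (\<lambda>i::nat. (of_int k gchoose i) *s
              mode (mode u (m + int i) v) (n + k - int i) w)"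
    and vac_left: "\<And>m v. mode vac m v = (if m = - 1 then v else 0)"
    and vac_right: "\<And>v. mode v (- 1) vac = v"
    and vac_right_nonneg: "\<And>v n. n \<ge> 0 \<Longrightarrow> mode v n vac = 0"
    and virasoro: "\<exists>c. \<forall>m n v. L m (L n v) - L n (L m v) =
          of_int (m - n) *s L (m + n) v
          + (if m + n = 0 then of_int (m ^ 3 - m) / 12 * c else 0) *s v"
    and derivative: "\<And>v n w. mode (L (- 1) v) n w = of_int (- n) *s mode v (n - 1) w"

end

theory Submission
  imports Defs
begin

text \<open>
Since the generators have weights $\frac32$ and $2$, every strong-generator monomial other than the
vacuum has weight at least $\frac32$. Hence $V_{(q)} = 0$ for $q < 0$ and for $q = \frac12, 1$,
while $V_{(0)} = \mathbb{C}\mathbf 1$. So there is a canonical functional \<open>vac_coeff\<close>, the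
coefficient of $\mathbf 1$, and the generators are quasi-primary ($L(1)a = 0$). Write $u^\dagger_n$
for \<open>adj_mode u n\<close>. An invariant form satisfies
$\langle v, w\rangle = \langle v_{-1}\mathbf 1, w\rangle = \langle \mathbf 1, v^\dagger_{-1} w\rangle$,
and $\langle \mathbf 1, \cdot\rangle$ vanishes on every $V_{(q)}$ with $q \neq 0$ because $L(0)$ is
self-adjoint. This forces $\langle v, w\rangle$ to be the coefficient of $\mathbf 1$ in
$v^\dagger_{-1} w$, which gives uniqueness (\<open>normalized_form_eq\<close>) and is taken as the definition
of \<open>form\<close>.

That this form is invariant rests on one operator identity, \<open>adj_mode_mode\<close>: for $a$ quasi-primary
and $v$ arbitrary, $(a_n v)^\dagger_k$ is the expression in $a^\dagger$ and $v^\dagger$ that results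
from expanding $(a_n v)_k$ by the Jacobi identity and reversing each product. It is used twice.
Applied to $k \geq -1$ and followed by \<open>vac_coeff\<close>, it first shows that $v^\dagger_r$ with
$r \geq 0$ maps into the kernel of \<open>vac_coeff\<close> (the dual of $v_r \mathbf 1 = 0$), and then that the
modes of a generator have the required adjoints (\<open>form_generator_mode\<close>). Applied to all $k$, it
shows that if $v$ has the required adjoints then so has $a_n v$
(\<open>adjoint_pair_generator_mode\<close>), and strong generation carries invariance to all of $V$. Symmetry
is an induction along monomials: moving a generator across the form twice produces the sign
$(-1)^{|a|}$ from the Koszul rule and the same sign from $e^{2\pi i q}$.

The kernel of the form is closed under all $v_n$ by invariance, hence is an ideal by skew-symmetry.
A proper ideal $J$ does not contain $\mathbf 1$ and is graded, so \<open>vac_coeff\<close> vanishes on it;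
then $\langle x, w\rangle = \langle w, x\rangle$, the coefficient of $\mathbf 1$ in
$w^\dagger_{-1} x \in J$, vanishes for $x \in J$. So the kernel contains every proper ideal and is the
unique maximal one.
\<close>

lemma Sum_any_eq_sum_lessThan:
  fixes g :: "nat \<Rightarrow> 'a::comm_monoid_add"
  assumes "\<And>i. i \<ge> N \<Longrightarrow> g i = 0"
  shows "Sum_any g = sum g {..<N}"
proof -
  have "{i. g i \<noteq> 0} \<subseteq> {..<N}"
    using assms by (auto simp: not_less[symmetric])
  then show ?thesis
    by (intro Sum_any.expand_superset) auto
qed

section \<open>Signs and phases\<close>

text \<open>
Weights enter doubled, as integers \<open>P\<close>, so that the parity of a homogeneous vector is the parity of
its doubled weight.
\<close>
definition koszul_sign :: "int \<Rightarrow> int \<Rightarrow> complex" where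
  "koszul_sign P Q = (if odd P \<and> odd Q then - 1 else 1)"

definition phase :: "int \<Rightarrow> complex" where
  "phase P = exp (of_real pi * \<i> * of_real (of_int P / 2))"

lemma koszul_sign_commute: "koszul_sign P Q = koszul_sign Q P"
  by (auto simp: koszul_sign_def)

lemma koszul_sign_power: "(- 1) ^ (a * b) = koszul_sign (2 * m + int a) (2 * n + int b)"
  by (auto simp: koszul_sign_def)

lemma koszul_sign_mode:
  "koszul_sign (P + Q - 2 * n - 2) R = koszul_sign P R * koszul_sign Q R"
  "koszul_sign R (P + Q - 2 * n - 2) = koszul_sign R P * koszul_sign R Q"
  by (auto simp: koszul_sign_def)

lemma phase_add: "phase (P + Q) = phase P * phase Q"
  by (simp add: phase_def add_divide_distrib ring_distribs exp_add)

lemma phase_0 [simp]: "phase 0 = 1"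
  by (simp add: phase_def)

lemma phase_2: "phase 2 = - 1"
  by (simp add: phase_def)

lemma phase_4: "phase 4 = 1"
  using phase_add[of 2 2] by (simp add: phase_2)

lemma phase_even: "phase (2 * n) = (- 1) powi n"
proof (induction n rule: int_induct[where k = 0])
  case base
  show ?case by simp
next
  case (step1 i)
  have "phase (2 * (i + 1)) = phase (2 * i) * phase 2"
    unfolding phase_add[symmetric] by (simp add: algebra_simps)
  then show ?case using step1 by (simp add: phase_2 power_int_add)
next
  case (step2 i)
  have "phase (2 * i) = phase (2 * (i - 1)) * phase 2"
    unfolding phase_add[symmetric] by (simp add: algebra_simps)
  then show ?case using step2 by (simp add: phase_2 power_int_diff)
qed

text \<open>
This is $e^{2\pi i q} = (-1)^{2q}$. It cancels the Koszul sign of an odd vector with itself, which is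
what makes the form symmetric also on the odd part.
\<close>
lemma phase_double: "phase P * phase P = (if odd P then - 1 else 1)"
proof -
  have "phase P * phase P = (- 1) powi P"
    unfolding phase_add[symmetric] phase_even[symmetric] by simp
  then show ?thesis by (simp add: power_int_minus_left)
qed

lemma phase_shift: "phase (Q - 2 * n - 2) = - (phase Q * (- 1) powi n)"
proof -
  have "phase (Q - 2 * n - 2) = phase Q * phase (2 * (- n - 1))"
    unfolding phase_add[symmetric] by (simp add: algebra_simps)
  also have "phase (2 * (- n - 1)) = - ((- 1) powi n)"
    unfolding phase_even by (simp add: power_int_minus_left)
  finally show ?thesis by simp
qed

lemma powi_minus_one_square [simp]: "(- 1 :: complex) powi n * (- 1) powi n = 1"
  by (simp add: power_int_minus_left)

section \<open>The grading\<close>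

context vertex_operator_superalgebra
begin

lemma mode_add_right: "mode v n (x + y) = mode v n x + mode v n y"
  and mode_scale_right: "mode v n (c *s x) = c *s mode v n x"
  using mode_linear[of v n] by (auto simp: Vector_Spaces.linear_iff)

lemma mode_add_left: "mode (x + y) n v = mode x n v + mode y n v"
  and mode_scale_left: "mode (c *s x) n v = c *s mode x n v"
  using Y_linear[of n v] by (auto simp: Vector_Spaces.linear_iff)

lemma mode_zero_right [simp]: "mode v n 0 = 0"
  using mode_scale_right[of v n 0 0] by simp

lemma mode_zero_left [simp]: "mode 0 n v = 0"
  using mode_scale_left[of 0 0 n v] by simp

lemma mode_sum_right: "mode v n (sum f A) = (\<Sum>i\<in>A. mode v n (f i))"
  by (induction A rule: infinite_finite_induct) (auto simp: mode_add_right)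

lemma mode_sum_left: "mode (sum f A) n v = (\<Sum>i\<in>A. mode (f i) n v)"
  by (induction A rule: infinite_finite_induct) (auto simp: mode_add_left)

lemma L_add: "L n (x + y) = L n x + L n y"
  and L_scale: "L n (c *s x) = c *s L n x"
  and L_zero [simp]: "L n 0 = 0"
  and L_sum: "L n (sum f A) = (\<Sum>i\<in>A. L n (f i))"
  by (simp_all add: L_def mode_add_right mode_scale_right mode_sum_right)

abbreviation W :: "int \<Rightarrow> 'v set" where
  "W P \<equiv> wt_space (of_int P / 2)"

lemma subspace_wt_space: "subspace (wt_space q)"
  by (auto simp: subspace_def wt_space_def L_add L_scale scale_right_distrib mult.commute)

lemma half_int_half_ints [simp]: "of_int P / 2 \<in> half_ints"
  by (simp add: half_ints_def)

lemma half_intsE: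
  assumes "q \<in> half_ints"
  obtains P where "q = of_int P / 2"
proof -
  from assms obtain P where "2 * q = of_int P"
    by (auto simp: half_ints_def elim: Ints_cases)
  then show ?thesis using that[of P] by simp
qed

lemma wt_component_decomposition: "decomposition half_ints wt_space v (\<lambda>q. wt_component q v)"
  unfolding wt_component_def using theI'[OF grading[of v]] by simp

lemma wt_component_eq:
  assumes "decomposition half_ints wt_space v f"
  shows "wt_component q v = f q"
  unfolding wt_component_def using the1_equality[OF grading, OF assms] by simp

lemma finite_wt_component: "finite {q. wt_component q v \<noteq> 0}"
  using wt_component_decomposition[of v] by (simp add: decomposition_def)

lemma wt_component_cases:
  obtains "wt_component q v = 0" | P where "q = of_int P / 2"
  using wt_component_decomposition[of v] by (metis decomposition_def half_intsE)

lemma wt_component_in: "wt_component (of_int P / 2) v \<in> W P"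
  using wt_component_decomposition[of v] by (simp add: decomposition_def)

lemma wt_component_add: "wt_component q (v + w) = wt_component q v + wt_component q w"
proof (rule wt_component_eq)
  let ?f = "\<lambda>q. wt_component q v" and ?g = "\<lambda>q. wt_component q w"
  have f: "decomposition half_ints wt_space v ?f" and g: "decomposition half_ints wt_space w ?g"
    by (rule wt_component_decomposition)+
  have fin: "finite {q. ?f q + ?g q \<noteq> 0}"
    by (rule finite_subset[OF _ finite_UnI[OF finite_wt_component[of v] finite_wt_component[of w]]])
      auto
  have "v + w = Sum_any ?f + Sum_any ?g"
    using f g by (simp add: decomposition_def Sum_any.expand_set)
  also have "\<dots> = Sum_any (\<lambda>q. ?f q + ?g q)"
    by (rule Sum_any.distrib[symmetric]) (rule finite_wt_component)+
  finally show "decomposition half_ints wt_space (v + w) (\<lambda>q. ?f q + ?g q)"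
    using f g fin
    by (auto simp: decomposition_def Sum_any.expand_set intro: subspace_add[OF subspace_wt_space])
qed

lemma wt_component_wt_space:
  assumes "v \<in> W P"
  shows "wt_component q v = (if q = of_int P / 2 then v else 0)"
proof -
  define r :: real where "r = of_int P / 2"
  have "{q. (if q = r then v else 0) \<noteq> 0} = (if v = 0 then {} else {r})"
    by auto
  moreover have "r \<in> half_ints" "v \<in> wt_space r"
    unfolding r_def using assms by simp_all
  ultimately have "decomposition half_ints wt_space v (\<lambda>q. if q = r then v else 0)"
    unfolding decomposition_def by (auto simp: subspace_0[OF subspace_wt_space])
  then show ?thesis
    unfolding r_def by (rule wt_component_eq)
qed

lemma wt_component_zero [simp]: "wt_component q 0 = 0"
  using wt_component_add[of q 0 0] by simp

lemma sum_wt_components: "v = (\<Sum>q | wt_component q v \<noteq> 0. wt_component q v)"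
  using wt_component_decomposition[of v] by (simp add: decomposition_def)

lemma homogeneous_induct [case_names homogeneous add]:
  assumes "\<And>P v. v \<in> W P \<Longrightarrow> A v"
    and "\<And>v w. A v \<Longrightarrow> A w \<Longrightarrow> A (v + w)"
  shows "A v"
proof -
  have zero: "A 0" using assms(1)[of 0 0] subspace_0[OF subspace_wt_space] by auto
  have "A (sum (\<lambda>q. wt_component q v) F)" if "finite F" for F
    using that
  proof (induction F)
    case empty
    show ?case using zero by simp
  next
    case (insert q F)
    have "A (wt_component q v)"
    proof (cases q v rule: wt_component_cases)
      case 1
      then show ?thesis using zero by simp
    next
      case (2 P)
      show ?thesis unfolding 2 by (rule assms(1)[OF wt_component_in])
    qed
    then show ?case using insert assms(2) by simp
  qed
  from this[OF finite_wt_component[of v]] show ?thesis using sum_wt_components[of v] by simp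
qed

lemma wt_component_scale: "wt_component q (c *s v) = c *s wt_component q v"
proof (induction v rule: homogeneous_induct)
  case (homogeneous P v)
  then show ?case
    using wt_component_wt_space[OF subspace_scale[OF subspace_wt_space homogeneous], of q c]
      wt_component_wt_space[OF homogeneous, of q] by simp
next
  case (add v w)
  then show ?case by (simp add: wt_component_add scale_right_distrib)
qed

lemma wt_space_parity: "v \<in> W (2 * n + int a) \<Longrightarrow> v \<in> parity_space a"
  unfolding parity_space_def by (rule span_base) (auto simp: add_divide_distrib)

lemma wt_space_parity_mod: "v \<in> W P \<Longrightarrow> v \<in> parity_space (nat (P mod 2))"
  by (rule wt_space_parity[where n = "P div 2"]) simp

lemma parity_space_induct [consumes 1, case_names zero add homogeneous]:
  assumes "v \<in> parity_space a"
    and "A 0"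
    and "\<And>v w. A v \<Longrightarrow> A w \<Longrightarrow> A (v + w)"
    and "\<And>n v. v \<in> W (2 * n + int a) \<Longrightarrow> A v"
  shows "A v"
  using assms(1) unfolding parity_space_def
proof (induction rule: span_induct_alt)
  case base
  show ?case by (rule assms(2))
next
  case (step c x y)
  then obtain n where "x \<in> wt_space (of_int n + of_nat a / 2)" by auto
  then have "x \<in> W (2 * n + int a)" by (simp add: add_divide_distrib)
  then have "c *s x \<in> W (2 * n + int a)" by (rule subspace_scale[OF subspace_wt_space])
  then show ?case using step assms(3,4) by blast
qed

lemma koszul_sign_mod: "(- 1) ^ (nat (P mod 2) * nat (Q mod 2)) = koszul_sign P Q"
  using koszul_sign_power[of "nat (P mod 2)" "nat (Q mod 2)" "P div 2" "Q div 2"] by simp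

text \<open>
The Jacobi identity with the sign expressed through doubled weights rather than through an index of
the parity space.
\<close>
lemma homogeneous_jacobi:
  assumes "u \<in> W P" "v \<in> W Q"
  shows "Sum_any (\<lambda>i::nat. ((- 1) ^ i * (of_int m gchoose i)) *s
             (mode u (m + k - int i) (mode v (n + int i) w)
              - (koszul_sign P Q * (- 1) powi m) *s
                  mode v (m + n - int i) (mode u (k + int i) w)))
          = Sum_any (\<lambda>i::nat. (of_int k gchoose i) *s
              mode (mode u (m + int i) v) (n + k - int i) w)"
  using jacobi[OF wt_space_parity_mod[OF assms(1)] wt_space_parity_mod[OF assms(2)]]
  by (simp add: koszul_sign_mod)

section \<open>Commutators with the conformal vector\<close>

text \<open>
At $m = 0$ the Jacobi identity is the commutator formula: on the left only $i = 0$ survives because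
of $\binom 0i$, on the right only $i \leq k$ because of $\binom ki$.
\<close>
lemma om_commutator:
  assumes v: "v \<in> W P"
  shows "mode om (int k) (mode v n w) - mode v n (mode om (int k) w)
    = (\<Sum>i\<le>k. of_nat (k choose i) *s mode (mode om (int i) v) (n + int k - int i) w)"
proof -
  have "Sum_any (\<lambda>i::nat. ((- 1) ^ i * (0 gchoose i)) *s
             (mode om (int k - int i) (mode v (n + int i) w)
              - mode v (n - int i) (mode om (int k + int i) w)))
      = (\<Sum>i<1. ((- 1) ^ i * (0 gchoose i)) *s
             (mode om (int k - int i) (mode v (n + int i) w)
              - mode v (n - int i) (mode om (int k + int i) w)))"
    by (rule Sum_any_eq_sum_lessThan) (auto simp: gr0_conv_Suc Suc_le_eq)
  also have "\<dots> = mode om (int k) (mode v n w) - mode v n (mode om (int k) w)"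
    by simp
  finally have lhs: "Sum_any (\<lambda>i::nat. ((- 1) ^ i * (0 gchoose i)) *s
             (mode om (int k - int i) (mode v (n + int i) w)
              - mode v (n - int i) (mode om (int k + int i) w))) = \<dots>" .
  have "Sum_any (\<lambda>i::nat. (of_nat k gchoose i) *s mode (mode om (int i) v) (n + int k - int i) w)
      = (\<Sum>i<Suc k. (of_nat k gchoose i) *s mode (mode om (int i) v) (n + int k - int i) w)"
    by (rule Sum_any_eq_sum_lessThan) (simp add: binomial_gbinomial[symmetric])
  also have "\<dots> = (\<Sum>i\<le>k. of_nat (k choose i) *s mode (mode om (int i) v) (n + int k - int i) w)"
    by (simp add: binomial_gbinomial[symmetric] lessThan_Suc_atMost)
  finally show ?thesis
    using jacobi[OF om_even wt_space_parity_mod[OF v], of 0 "int k" n w] lhs by simp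
qed

lemma L0_wt_space: "v \<in> W P \<Longrightarrow> L 0 v = (of_int P / 2) *s v"
  by (simp add: wt_space_def)

lemma L0_mode:
  assumes v: "v \<in> W P"
  shows "L 0 (mode v n w) = mode v n (L 0 w) + (of_int P / 2 - of_int n - 1) *s mode v n w"
proof -
  have "mode om 1 (mode v n w) - mode v n (mode om 1 w)
      = mode (mode om 0 v) (n + 1) w + mode (mode om 1 v) n w"
    using om_commutator[OF v, of 1 n w] by simp
  also have "mode (mode om 0 v) (n + 1) w = - of_int (n + 1) *s mode v n w"
    using derivative[of v "n + 1" w] by (simp add: L_def)
  also have "mode (mode om 1 v) n w = (of_int P / 2) *s mode v n w"
    using L0_wt_space[OF v] by (simp add: L_def mode_scale_left)
  finally show ?thesis
    by (simp add: L_def algebra_simps scale_left_distrib scale_left_diff_distrib)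
qed

text \<open>
For $L(1)v = 0$ the last term disappears, and commuting $L(1)$ past a mode of $v$ merely shifts that
mode. This is the reason why quasi-primary vectors have simple adjoints.
\<close>
lemma L1_mode:
  assumes v: "v \<in> W P"
  shows "L 1 (mode v n w) = mode v n (L 1 w) + of_int (P - n - 2) *s mode v (n + 1) w
           + mode (L 1 v) n w"
proof -
  have "mode om 2 (mode v n w) - mode v n (mode om 2 w)
      = mode (mode om 0 v) (n + 2) w + 2 *s mode (mode om 1 v) (n + 1) w + mode (mode om 2 v) n w"
    using om_commutator[OF v, of 2 n w] by (simp add: numeral_2_eq_2 add.commute[of 1 n])
  also have "mode (mode om 0 v) (n + 2) w = - of_int (n + 2) *s mode v (n + 1) w"
    using derivative[of v "n + 2" w] by (simp add: L_def algebra_simps)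
  also have "mode (mode om 1 v) (n + 1) w = (of_int P / 2) *s mode v (n + 1) w"
    using L0_wt_space[OF v] by (simp add: L_def mode_scale_left)
  finally show ?thesis
    by (simp add: L_def algebra_simps scale_left_distrib scale_left_diff_distrib)
qed

lemma mode_wt_space:
  assumes "v \<in> W P" "w \<in> W Q"
  shows "mode v n w \<in> W (P + Q - 2 * n - 2)"
  using L0_mode[OF assms(1), of n w] L0_wt_space[OF assms(2)]
  by (simp add: wt_space_def mode_scale_right scale_left_distrib[symmetric] field_simps)

lemma vac_wt_space: "vac \<in> W 0"
  by (simp add: wt_space_def L_def vac_right_nonneg)

text \<open>
As $\omega = \omega_{-1}\mathbf 1 = L(-2)\mathbf 1$, its weight can be read off from the bracket
$[L(0), L(-2)] = 2L(-2)$.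
\<close>
lemma om_wt_space: "om \<in> W 4"
proof -
  obtain c where "\<forall>m n v. L m (L n v) - L n (L m v) =
          of_int (m - n) *s L (m + n) v
          + (if m + n = 0 then of_int (m ^ 3 - m) / 12 * c else 0) *s v"
    using virasoro by blast
  from spec[OF spec[OF spec[OF this, of 0], of "- 2"], of vac]
  have "L 0 (L (- 2) vac) = 2 *s L (- 2) vac"
    using vac_wt_space by (simp add: wt_space_def L_def)
  then show ?thesis
    by (simp add: wt_space_def L_def vac_right)
qed

lemma L1_wt_space: "v \<in> W P \<Longrightarrow> L 1 v \<in> W (P - 2)"
  using mode_wt_space[OF om_wt_space, of v P 2] by (simp add: L_def)

text \<open>
The divided powers are the coefficients of $e^{zL(1)}$.
\<close>
definition divided_L1 :: "nat \<Rightarrow> 'v \<Rightarrow> 'v" where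
  "divided_L1 j v = (1 / fact j) *s (L 1 ^^ j) v"

lemma divided_L1_0 [simp]: "divided_L1 0 v = v"
  by (simp add: divided_L1_def)

lemma L1_divided_L1: "L 1 (divided_L1 j v) = of_nat (Suc j) *s divided_L1 (Suc j) v"
  by (simp add: divided_L1_def L_scale field_simps del: of_nat_Suc)

lemma divided_L1_wt_space: "v \<in> W P \<Longrightarrow> divided_L1 j v \<in> W (P - 2 * int j)"
proof (induction j)
  case 0
  then show ?case by simp
next
  case (Suc j)
  have "divided_L1 (Suc j) v = (1 / of_nat (Suc j)) *s L 1 (divided_L1 j v)"
    by (simp add: L1_divided_L1 del: of_nat_Suc)
  then show ?case
    using subspace_scale[OF subspace_wt_space L1_wt_space[OF Suc.IH[OF Suc.prems]]]
    by (simp add: algebra_simps)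
qed

text \<open>
The coefficients of the conjugation formula for $e^{zL(1)} a_n v$. In the induction step the summand
of index $i$ is reached by applying $L(1)$ either to the mode of $a$, with factor $j+1-i$, or to the
divided power of $v$, with factor $i$; the factors add up to $j+1$.
\<close>
lemma divided_L1_mode:
  assumes a: "a \<in> W Q" and qp: "L 1 a = 0"
  shows "divided_L1 j (mode a n v)
    = (\<Sum>i\<le>j. (of_int (Q - 2 - n) gchoose (j - i)) *s mode a (n + int (j - i)) (divided_L1 i v))"
proof (induction j)
  case 0
  show ?case by simp
next
  case (Suc j)
  let ?A = "of_int (Q - 2 - n) :: complex"
  let ?m = "\<lambda>i l. (?A gchoose l) *s mode a (n + int l) (divided_L1 i v)"
  have shift: "1 + (n + int l) = n + int (Suc l)" for l
    by simp
  have L1: "L 1 (?m i l) = of_nat (Suc l) *s ?m i (Suc l) + of_nat (Suc i) *s ?m (Suc i) l" for i l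
  proof -
    have "L 1 (?m i l) = (?A gchoose l) *s (of_nat (Suc i) *s mode a (n + int l) (divided_L1 (Suc i) v))
        + ((?A gchoose l) * (?A - of_nat l)) *s mode a (n + int (Suc l)) (divided_L1 i v)"
      by (simp add: L_scale L1_mode[OF a] qp L1_divided_L1 mode_scale_right scale_right_distrib
          diff_diff_eq add_ac shift del: of_nat_Suc)
    also have "(?A gchoose l) * (?A - of_nat l) = of_nat (Suc l) * (?A gchoose Suc l)"
      by (metis gbinomial_absorb_comp gbinomial_absorption mult.commute)
    finally show ?thesis
      by (simp add: algebra_simps del: of_nat_Suc)
  qed
  have "of_nat (Suc j) *s divided_L1 (Suc j) (mode a n v) = L 1 (\<Sum>i\<le>j. ?m i (j - i))"
    unfolding L1_divided_L1[symmetric] Suc.IH ..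
  also have "\<dots> = (\<Sum>i\<le>j. of_nat (Suc (j - i)) *s ?m i (Suc (j - i)))
                + (\<Sum>i\<le>j. of_nat (Suc i) *s ?m (Suc i) (j - i))"
    by (simp only: L_sum L1 sum.distrib)
  also have "(\<Sum>i\<le>j. of_nat (Suc (j - i)) *s ?m i (Suc (j - i)))
      = (\<Sum>i\<le>j. of_nat (Suc j - i) *s ?m i (Suc j - i))"
    by (intro sum.cong) (simp_all add: Suc_diff_le)
  also have "\<dots> = (\<Sum>i\<le>Suc j. of_nat (Suc j - i) *s ?m i (Suc j - i))"
    by simp
  also have "(\<Sum>i\<le>j. of_nat (Suc i) *s ?m (Suc i) (j - i))
      = (\<Sum>i\<le>Suc j. of_nat i *s ?m i (Suc j - i))"
    by (subst sum.atMost_Suc_shift) simp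
  also have "(\<Sum>i\<le>Suc j. of_nat (Suc j - i) *s ?m i (Suc j - i)) + \<dots>
      = (\<Sum>i\<le>Suc j. of_nat (Suc j) *s ?m i (Suc j - i))"
    unfolding sum.distrib[symmetric] scale_left_distrib[symmetric]
    by (intro sum.cong) (auto simp: of_nat_diff)
  also have "\<dots> = of_nat (Suc j) *s (\<Sum>i\<le>Suc j. ?m i (Suc j - i))"
    by (simp only: scale_sum_right)
  finally show ?case
    by (subst (asm) scale_cancel_left) (simp del: of_nat_Suc)
qed

section \<open>Coefficients of the adjoint field\<close>

lemma divided_L1_add: "divided_L1 j (x + y) = divided_L1 j x + divided_L1 j y"
  and divided_L1_scale: "divided_L1 j (c *s x) = c *s divided_L1 j x"
  and divided_L1_zero [simp]: "divided_L1 j 0 = 0"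
proof -
  have "(L 1 ^^ j) (x + y) = (L 1 ^^ j) x + (L 1 ^^ j) y"
    by (induction j) (simp_all add: L_add)
  then show "divided_L1 j (x + y) = divided_L1 j x + divided_L1 j y"
    by (simp add: divided_L1_def scale_right_distrib)
  have "(L 1 ^^ j) (c *s x) = c *s (L 1 ^^ j) x" for c x
    by (induction j) (simp_all add: L_scale)
  then have *: "divided_L1 j (c *s x) = c *s divided_L1 j x" for c x
    by (simp add: divided_L1_def mult.commute)
  show "divided_L1 j (c *s x) = c *s divided_L1 j x" by (rule *)
  show "divided_L1 j 0 = 0" using *[of 0 0] by simp
qed

lemma adj_coeff_eq: "adj_coeff u d
  = Sum_any (\<lambda>j. phase (int j - d) *s divided_L1 j (wt_component (of_int (int j - d) / 2) u))"
  unfolding adj_coeff_def divided_L1_def phase_def Let_def by simp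

lemma finite_adj_coeff_terms:
  "finite {j. phase (int j - d) *s divided_L1 j (wt_component (of_int (int j - d) / 2) u) \<noteq> 0}"
proof (rule finite_subset)
  show "{j. phase (int j - d) *s divided_L1 j (wt_component (of_int (int j - d) / 2) u) \<noteq> 0}
    \<subseteq> (\<lambda>j. of_int (int j - d) / 2) -` {q. wt_component q u \<noteq> 0}"
    by auto
  show "finite ((\<lambda>j. of_int (int j - d) / 2) -` {q. wt_component q u \<noteq> 0})"
    by (rule finite_vimageI[OF finite_wt_component]) (auto simp: inj_on_def)
qed

lemma adj_coeff_add: "adj_coeff (u + v) d = adj_coeff u d + adj_coeff v d"
  unfolding adj_coeff_eq Sum_any.distrib[OF finite_adj_coeff_terms finite_adj_coeff_terms, symmetric]
  by (simp add: wt_component_add divided_L1_add scale_right_distrib)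

text \<open>
On a homogeneous vector the power $z^d$ arises from exactly one power of $L(1)$, namely the one with
$j = 2q + d$.
\<close>
lemma adj_coeff_wt_space:
  assumes u: "u \<in> W P"
  shows "adj_coeff u d = (if P + d < 0 then 0 else phase P *s divided_L1 (nat (P + d)) u)"
proof -
  have "adj_coeff u d = (\<Sum>j\<in>(if P + d < 0 then {} else {nat (P + d)}).
      phase (int j - d) *s divided_L1 j (wt_component (of_int (int j - d) / 2) u))"
    unfolding adj_coeff_eq
    by (rule Sum_any.expand_superset) (auto simp: wt_component_wt_space[OF u])
  then show ?thesis
    by (simp add: wt_component_wt_space[OF u])
qed

lemma adj_coeff_scale: "adj_coeff (c *s u) d = c *s adj_coeff u d"
proof (induction u rule: homogeneous_induct)
  case (homogeneous P u)
  then show ?case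
    using adj_coeff_wt_space[OF homogeneous, of d]
      adj_coeff_wt_space[OF subspace_scale[OF subspace_wt_space homogeneous], of c d]
    by (simp add: divided_L1_scale mult.commute)
next
  case (add u v)
  then show ?case by (simp add: adj_coeff_add scale_right_distrib)
qed

lemma truncation_eventually: "eventually (\<lambda>l::nat. mode u (n + int l) v = 0) sequentially"
proof -
  obtain N where N: "\<forall>n\<ge>N. mode u n v = 0" using truncation by blast
  have "mode u (n + int l) v = 0" if "l \<ge> nat (N - n)" for l
    using that N by (intro N[rule_format]) linarith
  then show ?thesis unfolding eventually_sequentially by blast
qed

section \<open>Iterated modes, graded subspaces and ideals\<close>

text \<open>
The Jacobi identity at $k = 0$, expressing modes of $u_m v$ through products of modes of $u$ and $v$.
The finite sum is asserted for all large cut-offs, so that several such expansions can be cut off at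
a common place and compared summand by summand.
\<close>
lemma mode_mode_associator:
  assumes "u \<in> W P" "v \<in> W Q"
  shows "eventually (\<lambda>N. mode (mode u m v) n w =
    (\<Sum>i<N. ((- 1) ^ i * (of_int m gchoose i)) *s
      (mode u (m - int i) (mode v (n + int i) w)
       - (koszul_sign P Q * (- 1) powi m) *s mode v (m + n - int i) (mode u (int i) w)))) sequentially"
proof -
  have "eventually (\<lambda>i. mode v (n + int i) w = 0 \<and> mode u (0 + int i) w = 0) sequentially"
    by (intro eventually_conj truncation_eventually)
  then obtain S where S: "\<And>i. i \<ge> S \<Longrightarrow> mode v (n + int i) w = 0 \<and> mode u (int i) w = 0"
    unfolding eventually_sequentially by auto
  show ?thesis
  proof (rule eventually_sequentiallyI)
    fix N assume N: "S \<le> N"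
    let ?t = "\<lambda>i::nat. ((- 1) ^ i * (of_int m gchoose i)) *s
      (mode u (m - int i) (mode v (n + int i) w)
       - (koszul_sign P Q * (- 1) powi m) *s mode v (m + n - int i) (mode u (int i) w))"
    have "Sum_any ?t = sum ?t {..<N}"
      by (rule Sum_any_eq_sum_lessThan) (use S N in simp)
    moreover have "Sum_any (\<lambda>i::nat. (0 gchoose i) *s mode (mode u (m + int i) v) (n - int i) w)
        = (\<Sum>i<1. (0 gchoose i) *s mode (mode u (m + int i) v) (n - int i) w)"
      by (rule Sum_any_eq_sum_lessThan) (auto simp: gr0_conv_Suc Suc_le_eq)
    ultimately show "mode (mode u m v) n w = sum ?t {..<N}"
      using homogeneous_jacobi[OF assms, of m 0 n w] by simp
  qed
qed

text \<open>
An \<open>L 0\<close>-stable subspace is graded: $L(0) - p$ removes the component of weight $p$ and rescales the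
others by nonzero factors, so the number of components can be reduced one at a time.
\<close>
lemma wt_components_in_invariant_subspace:
  assumes "subspace I" "\<And>x. x \<in> I \<Longrightarrow> L 0 x \<in> I" "x \<in> I"
  shows "wt_component q x \<in> I"
proof -
  have *: "\<forall>q\<in>F. f q \<in> I"
    if "finite F" "\<And>q. q \<in> F \<Longrightarrow> f q \<in> wt_space q" "sum f F \<in> I" for F and f :: "real \<Rightarrow> 'v"
    using that
  proof (induction F arbitrary: f)
    case empty
    then show ?case by simp
  next
    case (insert p F)
    let ?g = "\<lambda>q. of_real (q - p) *s f q"
    have eig: "L 0 (f q) - of_real p *s f q = ?g q" if "q \<in> insert p F" for q
      using insert.prems(1)[OF that] by (simp add: wt_space_def scale_left_diff_distrib)
    have "L 0 (sum f (insert p F)) - of_real p *s sum f (insert p F) = sum ?g (insert p F)"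
      unfolding L_sum scale_sum_right sum_subtractf[symmetric]
      by (rule sum.cong) (use eig in auto)
    also have "\<dots> = sum ?g F" using insert.hyps by simp
    finally have "sum ?g F = L 0 (sum f (insert p F)) - of_real p *s sum f (insert p F)" ..
    then have "sum ?g F \<in> I"
      using insert.prems(2) by (simp only: subspace_diff[OF assms(1)] subspace_scale[OF assms(1)] assms(2))
    moreover have "?g q \<in> wt_space q" if "q \<in> F" for q
      using insert.prems(1)[of q] that by (intro subspace_scale[OF subspace_wt_space]) simp
    ultimately have g: "\<forall>q\<in>F. ?g q \<in> I" using insert.IH[of ?g] by blast
    have F: "f q \<in> I" if "q \<in> F" for q
    proof -
      have "q \<noteq> p" using that insert.hyps by auto
      then have "f q = (1 / of_real (q - p)) *s ?g q" by simp
      then show ?thesis using g that subspace_scale[OF assms(1)] by metis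
    qed
    then have "sum f F \<in> I" by (intro subspace_sum[OF assms(1)]) auto
    then have "f p \<in> I"
      using insert.prems(2) insert.hyps subspace_diff[OF assms(1), of "f p + sum f F" "sum f F"]
      by simp
    then show ?case using F by simp
  qed
  have "wt_component q x \<in> wt_space q" if "wt_component q x \<noteq> 0" for q
    using that wt_component_decomposition[of x] by (auto simp: decomposition_def)
  then have "\<forall>q\<in>{q. wt_component q x \<noteq> 0}. wt_component q x \<in> I"
    using assms(3) by (intro * finite_wt_component) (simp_all flip: sum_wt_components)
  then show ?thesis using subspace_0[OF assms(1)] by (cases "wt_component q x = 0") auto
qed

text \<open>
A form of skew-symmetry: the modes $x_m v$ are combinations of the vectors
$(v_{m+i}x)_{-1-i}\mathbf 1$, and $y_{-1-i}\mathbf 1 = \frac{1}{i!}L(-1)^i y$ lies in every left ideal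
that contains $y$.
\<close>
lemma left_ideal_is_ideal:
  assumes I: "subspace I" and left: "\<And>x v n. x \<in> I \<Longrightarrow> mode v n x \<in> I"
  shows "is_ideal I"
proof -
  have creation: "mode y (- 1 - int i) vac \<in> I" if "y \<in> I" for y i
    using that
  proof (induction i arbitrary: y)
    case 0
    then show ?case by (simp add: vac_right)
  next
    case (Suc i)
    have "mode (L (- 1) y) (- 1 - int i) vac \<in> I"
      using Suc.IH left[OF Suc.prems] by (simp add: L_def)
    moreover have "mode (L (- 1) y) (- 1 - int i) vac
        = of_nat (Suc i) *s mode y (- 1 - int (Suc i)) vac"
      by (simp add: derivative algebra_simps)
    ultimately have "(1 / of_nat (Suc i)) *s of_nat (Suc i) *s mode y (- 1 - int (Suc i)) vac \<in> I"
      using subspace_scale[OF I] by metis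
    then show ?case by (simp del: of_nat_Suc)
  qed
  have right_homogeneous: "mode x m v \<in> I" if x: "x \<in> I" "x \<in> W Q" and v: "v \<in> W P" for x v m P Q
  proof -
    let ?c = "koszul_sign P Q * (- 1) powi m"
    \<comment> \<open>The Jacobi identity for v and x with k = -1, n = 0, applied to the vacuum: the first
      family on the left vanishes and the second leaves only the mode of x that is wanted.\<close>
    have rhs: "Sum_any (\<lambda>i::nat. (of_int (- 1) gchoose i) *s mode (mode v (m + int i) x) (- 1 - int i) vac) \<in> I"
      unfolding Sum_any.expand_set using creation left[OF x(1)]
      by (intro subspace_sum[OF I] subspace_scale[OF I]) auto
    have "Sum_any (\<lambda>i::nat. ((- 1) ^ i * (of_int m gchoose i)) *s
             (mode v (m + - 1 - int i) (mode x (0 + int i) vac)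
              - ?c *s mode x (m + 0 - int i) (mode v (- 1 + int i) vac)))
        = (\<Sum>i<1. ((- 1) ^ i * (of_int m gchoose i)) *s
             (mode v (m + - 1 - int i) (mode x (0 + int i) vac)
              - ?c *s mode x (m + 0 - int i) (mode v (- 1 + int i) vac)))"
      by (rule Sum_any_eq_sum_lessThan) (simp add: vac_right_nonneg)
    then have "- (?c *s mode x m v) \<in> I"
      using homogeneous_jacobi[OF v x(2), of m "- 1" 0 vac] rhs
      by (simp add: vac_right vac_right_nonneg)
    then have "?c *s - (?c *s mode x m v) \<in> I" by (rule subspace_scale[OF I])
    moreover have "?c * ?c = 1"
      by (simp add: koszul_sign_def power_int_minus_left)
    ultimately have "- mode x m v \<in> I" by (simp only: scale_minus_right scale_scale scale_one)
    then show ?thesis using subspace_neg[OF I] by fastforce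
  qed
  have "mode x m v \<in> I" if x: "x \<in> I" for x v m
  proof (induction v rule: homogeneous_induct)
    case (homogeneous P v)
    have "mode (wt_component q x) m v \<in> I" for q
    proof (cases q x rule: wt_component_cases)
      case 1
      then show ?thesis by (simp add: subspace_0[OF I])
    next
      case R: (2 R)
      have "wt_component q x \<in> I"
        by (rule wt_components_in_invariant_subspace[OF I _ x]) (simp add: L_def left)
      then show ?thesis
        using right_homogeneous[OF _ wt_component_in homogeneous] by (simp add: R)
    qed
    then have "(\<Sum>q | wt_component q x \<noteq> 0. mode (wt_component q x) m v) \<in> I"
      by (intro subspace_sum[OF I])
    then show ?case by (simp flip: mode_sum_left sum_wt_components)
  next
    case (add v w)
    then show ?case by (simp add: mode_add_right subspace_add[OF I])
  qed
  then show ?thesis using I left by (simp add: is_ideal_def)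
qed

end

section \<open>Strong generation in weights 3/2 and 2\<close>

locale vosa_generated_in_low_weight = vertex_operator_superalgebra scale mode vac om
  for scale :: "complex \<Rightarrow> 'v::ab_group_add \<Rightarrow> 'v" (infixr "*s" 75)
    and mode :: "'v \<Rightarrow> int \<Rightarrow> 'v \<Rightarrow> 'v"
    and vac :: 'v
    and om :: 'v +
  assumes nontrivial: "(UNIV :: 'v set) \<noteq> {0}"
    and strongly_generated: "strongly_generated_by {x + y | x y. x \<in> wt_space (3 / 2) \<and> y \<in> wt_space 2}"
begin

lemma vac_nonzero: "vac \<noteq> 0"
  using nontrivial vac_right mode_zero_right by (metis UNIV_eq_I singletonI)

text \<open>
Strong-generator monomials with homogeneous factors, together with their doubled weight. Splitting a
generator $x + y$ with $x \in V_{(3/2)}$, $y \in V_{(2)}$ makes weight arguments available.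
\<close>
inductive monomial :: "'v \<Rightarrow> int \<Rightarrow> bool" where
  vac: "monomial vac 0"
| mode: "\<lbrakk>monomial v P; a \<in> W Q; Q = 3 \<or> Q = 4; n \<ge> 1\<rbrakk>
    \<Longrightarrow> monomial (mode a (- n) v) (Q + P + 2 * n - 2)"

lemma monomial_wt_space: "monomial v P \<Longrightarrow> v \<in> W P"
proof (induction rule: monomial.induct)
  case vac
  show ?case by (rule vac_wt_space)
next
  case (mode v P a Q n)
  then show ?case using mode_wt_space[of a Q v P "- n"] by simp
qed

lemma monomial_wt: "monomial v P \<Longrightarrow> P = 0 \<and> v = vac \<or> P \<ge> 3"
  by (induction rule: monomial.induct) auto

lemma span_monomials: "span {v. \<exists>P. monomial v P} = UNIV"
proof -
  let ?M = "span {v. \<exists>P. monomial v P}"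
  have step: "mode a (- n) v \<in> ?M" if "v \<in> ?M" "a \<in> W Q" "Q = 3 \<or> Q = 4" "n \<ge> 1" for a Q n v
    using that(1)
  proof (induction rule: span_induct_alt)
    case base
    show ?case by (simp add: span_zero)
  next
    case (step c x y)
    then have "mode a (- n) x \<in> ?M"
      using monomial.mode that(2-4) by (blast intro: span_base)
    with step show ?case
      by (simp add: mode_add_right mode_scale_right span_add span_scale)
  qed
  let ?T = "{x + y | x y. x \<in> wt_space (3 / 2) \<and> y \<in> wt_space 2}"
  have "foldr (\<lambda>(a, n). mode a (- n)) xs vac \<in> ?M"
    if "\<forall>(a, n) \<in> set xs. a \<in> ?T \<and> 0 < n" for xs
    using that
  proof (induction xs)
    case Nil
    show ?case using monomial.vac by (auto intro: span_base)
  next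
    case (Cons p xs)
    obtain x y n where p: "p = (x + y, n)" "x \<in> W 3" "y \<in> W 4" "n \<ge> 1"
      using Cons.prems by auto
    have "foldr (\<lambda>(a, n). mode a (- n)) xs vac \<in> ?M" using Cons by simp
    with step[OF this p(2) _ p(4)] step[OF this p(3) _ p(4)] show ?case
      by (simp add: p(1) mode_add_left span_add)
  qed
  then have "insert vac {foldr (\<lambda>(a, n). mode a (- n)) xs vac | xs.
             xs \<noteq> [] \<and> (\<forall>(a, n) \<in> set xs. a \<in> ?T \<and> 0 < n)} \<subseteq> ?M"
    using monomial.vac by (auto intro: span_base)
  from span_minimal[OF this subspace_span] show ?thesis
    using strongly_generated unfolding strongly_generated_by_def by auto
qed

lemma monomial_induct [case_names zero add scale monomial]:
  assumes "A 0" "\<And>v w. A v \<Longrightarrow> A w \<Longrightarrow> A (v + w)" "\<And>c v. A v \<Longrightarrow> A (c *s v)"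
    and "\<And>v P. monomial v P \<Longrightarrow> A v"
  shows "A v"
proof -
  have "v \<in> span {v. \<exists>P. monomial v P}" using span_monomials by simp
  then show ?thesis
    by (induction rule: span_induct_alt) (use assms in auto)
qed

text \<open>
Each factor $a_{-n}$ with $n \geq 1$ raises the weight by at least $\frac32$, so no monomial has one
of these weights.
\<close>
lemma wt_component_vanishes:
  assumes "P \<noteq> 0" "P < 3"
  shows "wt_component (of_int P / 2) v = 0"
proof (induction v rule: monomial_induct)
  case (monomial v R)
  then show ?case
    using assms monomial_wt[OF monomial] wt_component_wt_space[OF monomial_wt_space[OF monomial]]
    by auto
qed (simp_all add: wt_component_add wt_component_scale)

lemma wt_space_trivial: "v \<in> W P \<Longrightarrow> P \<noteq> 0 \<Longrightarrow> P < 3 \<Longrightarrow> v = 0"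
  using wt_component_vanishes wt_component_wt_space[of v P "of_int P / 2"] by simp

lemma wt_component_0_vac: "\<exists>c. wt_component 0 v = c *s vac"
proof (induction v rule: monomial_induct)
  case zero
  show ?case by (rule exI[of _ 0]) simp
next
  case (add v w)
  then show ?case by (metis wt_component_add scale_left_distrib)
next
  case (scale c v)
  then show ?case by (metis wt_component_scale scale_scale)
next
  case (monomial v R)
  have "wt_component 0 v = (if R = 0 then 1 else 0) *s vac"
    using monomial_wt[OF monomial] wt_component_wt_space[OF monomial_wt_space[OF monomial], of 0]
    by auto
  then show ?case by blast
qed

text \<open>
The functional $\langle\mathbf 1, \cdot\rangle$ of the form to be constructed.
\<close>
definition vac_coeff :: "'v \<Rightarrow> complex" where
  "vac_coeff v = (THE c. wt_component 0 v = c *s vac)"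

lemma wt_component_0: "wt_component 0 v = vac_coeff v *s vac"
proof -
  obtain c where c: "wt_component 0 v = c *s vac" using wt_component_0_vac by blast
  then have "vac_coeff v = c"
    unfolding vac_coeff_def using vac_nonzero by (intro the_equality) auto
  with c show ?thesis by simp
qed

lemma vac_coeffI: "wt_component 0 v = c *s vac \<Longrightarrow> vac_coeff v = c"
  using vac_nonzero by (simp add: wt_component_0)

lemma vac_coeff_add: "vac_coeff (v + w) = vac_coeff v + vac_coeff w"
  and vac_coeff_scale: "vac_coeff (c *s v) = c * vac_coeff v"
  by (rule vac_coeffI, simp add: wt_component_add wt_component_scale wt_component_0 scale_left_distrib)+

lemma vac_coeff_zero [simp]: "vac_coeff 0 = 0"
  using vac_coeff_scale[of 0 0] by simp

lemma vac_coeff_sum: "vac_coeff (sum f A) = (\<Sum>i\<in>A. vac_coeff (f i))"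
  by (induction A rule: infinite_finite_induct) (auto simp: vac_coeff_add)

lemma vac_coeff_wt_space: "v \<in> W P \<Longrightarrow> P \<noteq> 0 \<Longrightarrow> vac_coeff v = 0"
  by (rule vac_coeffI) (simp add: wt_component_wt_space)

lemma vac_coeff_vac [simp]: "vac_coeff vac = 1"
  by (rule vac_coeffI) (use wt_component_wt_space[OF vac_wt_space] in simp)

lemma wt_space_0: "v \<in> W 0 \<Longrightarrow> v = vac_coeff v *s vac"
  using wt_component_0[of v] wt_component_wt_space[of v 0 0] by simp

section \<open>Adjoint modes\<close>

lemma divided_L1_vanishes: "v \<in> W P \<Longrightarrow> P < 2 * int j \<Longrightarrow> divided_L1 j v = 0"
  using divided_L1_wt_space[of v P j] wt_space_trivial[of _ "P - 2 * int j"] by simp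

lemma finite_adj_coeff: "finite {d. adj_coeff u d \<noteq> 0}"
proof (induction u rule: homogeneous_induct)
  case (homogeneous P u)
  have "{d. adj_coeff u d \<noteq> 0} \<subseteq> {- P..0} \<union> {0..\<bar>P\<bar>}"
    using divided_L1_vanishes[OF homogeneous]
    by (auto simp: adj_coeff_wt_space[OF homogeneous] not_less abs_if split: if_splits)
  then show ?case using finite_subset by blast
next
  case (add u v)
  then show ?case
    by (rule_tac finite_subset[OF _ finite_UnI[OF add]]) (auto simp: adj_coeff_add)
qed

lemma adj_mode_eq_sum:
  assumes "finite A" "{d. adj_coeff u d \<noteq> 0} \<subseteq> A"
  shows "adj_mode u n w = (\<Sum>d\<in>A. mode (adj_coeff u d) (- n - 2 - d) w)"
  unfolding adj_mode_def by (rule Sum_any.expand_superset) (use assms in auto)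

lemma adj_mode_add_right: "adj_mode u n (x + y) = adj_mode u n x + adj_mode u n y"
  and adj_mode_scale_right: "adj_mode u n (c *s x) = c *s adj_mode u n x"
  and adj_mode_scale_left: "adj_mode (c *s u) n x = c *s adj_mode u n x"
proof -
  note eq = adj_mode_eq_sum[OF finite_adj_coeff[of u] subset_refl]
  show "adj_mode u n (x + y) = adj_mode u n x + adj_mode u n y"
    by (simp add: eq mode_add_right sum.distrib)
  show "adj_mode u n (c *s x) = c *s adj_mode u n x"
    by (simp add: eq mode_scale_right scale_sum_right)
  have "{d. adj_coeff (c *s u) d \<noteq> 0} \<subseteq> {d. adj_coeff u d \<noteq> 0}"
    by (auto simp: adj_coeff_scale)
  from adj_mode_eq_sum[OF finite_adj_coeff[of u] this]
  show "adj_mode (c *s u) n x = c *s adj_mode u n x"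
    by (simp add: eq adj_coeff_scale mode_scale_left scale_sum_right)
qed

lemma adj_mode_add_left: "adj_mode (u + v) n w = adj_mode u n w + adj_mode v n w"
proof -
  let ?A = "{d. adj_coeff u d \<noteq> 0} \<union> {d. adj_coeff v d \<noteq> 0}"
  have fin: "finite ?A" using finite_adj_coeff by simp
  have "adj_mode (u + v) n w = (\<Sum>d\<in>?A. mode (adj_coeff (u + v) d) (- n - 2 - d) w)"
    by (rule adj_mode_eq_sum[OF fin]) (auto simp: adj_coeff_add)
  also have "\<dots> = adj_mode u n w + adj_mode v n w"
    unfolding adj_coeff_add mode_add_left sum.distrib
    using adj_mode_eq_sum[OF fin, of u n w] adj_mode_eq_sum[OF fin, of v n w] by auto
  finally show ?thesis .
qed

lemma adj_mode_zero [simp]: "adj_mode 0 n w = 0" "adj_mode u n 0 = 0"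
  using adj_mode_scale_left[of 0 0 n w] adj_mode_scale_right[of u n 0 0] by simp_all

text \<open>
The explicit finite formula for adjoint modes. The cut-off \<open>N\<close> is free above half of \<open>P\<close>, where the
divided powers of $L(1)$ reach negative weight.
\<close>
lemma adj_mode_wt_space:
  assumes u: "u \<in> W P" and N: "P < 2 * int N"
  shows "adj_mode u n w = phase P *s (\<Sum>j<N. mode (divided_L1 j u) (P - 2 - n - int j) w)"
proof -
  let ?A = "(\<lambda>j. int j - P) ` {..<N}"
  have sub: "{d. adj_coeff u d \<noteq> 0} \<subseteq> ?A"
  proof (intro subsetI)
    fix d assume "d \<in> {d. adj_coeff u d \<noteq> 0}"
    then have "P + d \<ge> 0" "divided_L1 (nat (P + d)) u \<noteq> 0"
      by (auto simp: adj_coeff_wt_space[OF u] split: if_splits)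
    moreover from this have "nat (P + d) < N"
      using divided_L1_vanishes[OF u, of "nat (P + d)"] N by linarith
    ultimately show "d \<in> ?A"
      by (intro image_eqI[where x = "nat (P + d)"]) auto
  qed
  have "adj_mode u n w = (\<Sum>d\<in>?A. mode (adj_coeff u d) (- n - 2 - d) w)"
    by (rule adj_mode_eq_sum) (use sub in auto)
  also have "\<dots> = (\<Sum>j<N. mode (adj_coeff u (int j - P)) (- n - 2 - (int j - P)) w)"
    by (subst sum.reindex) (auto simp: inj_on_def)
  also have "\<dots> = phase P *s (\<Sum>j<N. mode (divided_L1 j u) (P - 2 - n - int j) w)"
    unfolding scale_sum_right
    by (intro sum.cong) (simp_all add: adj_coeff_wt_space[OF u] mode_scale_left algebra_simps)
  finally show ?thesis .
qed

lemma adj_mode_quasi_primary: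
  assumes u: "u \<in> W P" and qp: "L 1 u = 0"
  shows "adj_mode u n w = phase P *s mode u (P - 2 - n) w"
proof -
  have "(L 1 ^^ j) 0 = 0" for j
    by (induction j) simp_all
  then have "divided_L1 (Suc j) u = 0" for j
    unfolding divided_L1_def funpow_Suc_right o_apply qp by simp
  then have "(\<Sum>j<Suc (nat P). mode (divided_L1 j u) (P - 2 - n - int j) w) = mode u (P - 2 - n) w"
    by (subst sum.lessThan_Suc_shift) simp
  moreover have "P < 2 * int (Suc (nat P))" by simp
  ultimately show ?thesis using adj_mode_wt_space[OF u, of "Suc (nat P)"] by metis
qed

text \<open>
The central identity. Let $v^{(i)} = L(1)^i v / i!$. Expanding $e^{zL(1)}(a_n v)$ by
\<open>divided_L1_mode\<close> turns the left side into a sum over $i$ and $l$ of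
$\binom{2q-2-n}{l}\,(a_{n+l} v^{(i)})_{r-i-l}\, w$ with a fixed $r$, where $q$ is the weight of $a$.
For fixed $i$ the sum over $l$ is exactly the right side of the Jacobi identity for $a$ and $v^{(i)}$
with $m = n$ and $k = 2q-2-n$. Its left side is a sum over $s$ of products of modes of $a$ and
$v^{(i)}$, and summing these over $i$ first reassembles adjoint modes of $v$.
\<close>
lemma adj_mode_mode:
  assumes a: "a \<in> W Q" and qp: "L 1 a = 0" and v: "v \<in> W P"
  shows "eventually (\<lambda>N. adj_mode (mode a n v) k w = phase (Q - 2 * n - 2) *s
    (\<Sum>s<N. ((- 1) ^ s * (of_int n gchoose s)) *s
      (mode a (Q - 2 - int s) (adj_mode v (n + k - int s) w)
       - (koszul_sign Q P * (- 1) powi n) *s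
           adj_mode v (k + int s) (mode a (Q - 2 - n + int s) w)))) sequentially"
proof -
  \<comment> \<open>M bounds i, T bounds l and S bounds s; R is the mode index of the outer field at i = l = 0.\<close>
  define M where "M = Suc (nat P)"
  have M: "P < 2 * int M" by (simp add: M_def)
  define e where "e i = divided_L1 i v" for i
  have e: "e i \<in> W (P - 2 * int i)" for i
    unfolding e_def by (rule divided_L1_wt_space[OF v])
  have e0: "e i = 0" if "i \<ge> M" for i
    unfolding e_def using that M by (intro divided_L1_vanishes[OF v]) linarith
  define R where "R = Q + P - 2 * n - 4 - k"
  define g where "g i l = (of_int (Q - 2 - n) gchoose l) *s
      mode (mode a (n + int l) (e i)) (R - int i - int l) w" for i l
  define h where "h i s = ((- 1) ^ s * (of_int n gchoose s)) *s
      (mode a (Q - 2 - int s) (mode (e i) (P - 2 - (n + k - int s) - int i) w)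
       - (koszul_sign Q P * (- 1) powi n) *s
         mode (e i) (P - 2 - (k + int s) - int i) (mode a (Q - 2 - n + int s) w))" for i s
  have "eventually (\<lambda>l. \<forall>i\<in>{..<M}. mode a (n + int l) (e i) = 0) sequentially"
    by (intro eventually_ball_finite ballI truncation_eventually) auto
  then obtain T where "\<forall>l\<ge>T. \<forall>i\<in>{..<M}. mode a (n + int l) (e i) = 0"
    unfolding eventually_sequentially by blast
  then have g0: "g i l = 0" if "i \<ge> M \<or> l \<ge> T" for i l
    using that e0[of i] by (cases "i < M") (auto simp: g_def)
  have g_support: "g i l \<noteq> 0 \<Longrightarrow> i < M \<and> l < T" for i l
    by (rule conjI; rule ccontr) (simp_all add: g0)
  have "eventually (\<lambda>s. (\<forall>i\<in>{..<M}. mode (e i) ((P - 2 - n - k - int i) + int s) w = 0)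
      \<and> mode a (Q - 2 - n + int s) w = 0) sequentially"
    by (intro eventually_conj eventually_ball_finite ballI truncation_eventually) auto
  then obtain S where S: "\<forall>s\<ge>S. (\<forall>i\<in>{..<M}. mode (e i) ((P - 2 - n - k - int i) + int s) w = 0)
      \<and> mode a (Q - 2 - n + int s) w = 0"
    unfolding eventually_sequentially by blast
  have idx: "P - 2 - (n + k - int s) - int i = (P - 2 - n - k - int i) + int s" for s i
    by simp
  have h0: "h i s = 0" if "s \<ge> S" for i s
    using S[rule_format, OF that] e0[of i] unfolding h_def idx
    by (cases "i < M") auto
  have jac: "Sum_any (g i) = Sum_any (h i)" for i
    using homogeneous_jacobi[OF a e[of i], of n "Q - 2 - n" "P - 2 - n - k - int i" w]
    unfolding g_def h_def R_def
    by (simp add: koszul_sign_def algebra_simps)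
  \<comment> \<open>Any cut-off J that exceeds every i + l with i < M and l < T and is admissible
    in adj_mode_wt_space.\<close>
  define J where "J = M + T + nat (Q + P - 2 * n - 2) + 1"
  have J: "Q + P - 2 * n - 2 < 2 * int J" by (simp add: J_def)
  have lhs: "(\<Sum>j<J. mode (divided_L1 j (mode a n v)) (Q + P - 2 * n - 2 - 2 - k - int j) w)
      = (\<Sum>i<M. Sum_any (g i))"
  proof -
    have "(\<Sum>j<J. mode (divided_L1 j (mode a n v)) (Q + P - 2 * n - 2 - 2 - k - int j) w)
      = (\<Sum>j<J. \<Sum>i\<le>j. g i (j - i))"
      unfolding divided_L1_mode[OF a qp] mode_sum_left
      by (intro sum.cong) (auto simp: g_def R_def e_def mode_scale_left of_nat_diff algebra_simps)
    also have "\<dots> = (\<Sum>(i, l)\<in>{(i, l). i + l < J}. g i l)"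
      by (rule sum.triangle_reindex[symmetric])
    also have "\<dots> = (\<Sum>(i, l)\<in>{..<M} \<times> {..<T}. g i l)"
    proof (rule sum.mono_neutral_right)
      show "finite {(i, l). i + l < J}"
        by (rule finite_subset[of _ "{..<J} \<times> {..<J}"]) auto
    qed (use g_support in \<open>auto simp: J_def\<close>)
    also have "\<dots> = (\<Sum>i<M. Sum_any (g i))"
      unfolding sum.cartesian_product[symmetric]
      by (intro sum.cong refl Sum_any_eq_sum_lessThan[symmetric]) (simp add: g0)
    finally show ?thesis .
  qed
  show ?thesis
  proof (rule eventually_sequentiallyI)
    fix N assume N: "S \<le> N"
    have "(\<Sum>i<M. Sum_any (g i)) = (\<Sum>i<M. \<Sum>s<N. h i s)"
      unfolding jac by (intro sum.cong refl Sum_any_eq_sum_lessThan h0) (use N in simp)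
    also have "\<dots> = (\<Sum>s<N. \<Sum>i<M. h i s)"
      by (rule sum.swap)
    finally have sums: "(\<Sum>i<M. Sum_any (g i)) = (\<Sum>s<N. \<Sum>i<M. h i s)" .
    let ?t = "\<lambda>s::nat. ((- 1) ^ s * (of_int n gchoose s)) *s
        (mode a (Q - 2 - int s) (adj_mode v (n + k - int s) w)
         - (koszul_sign Q P * (- 1) powi n) *s
             adj_mode v (k + int s) (mode a (Q - 2 - n + int s) w))"
    have "?t s = phase P *s (\<Sum>i<M. h i s)" for s
      unfolding h_def adj_mode_wt_space[OF v M] e_def
      by (simp add: mode_sum_right mode_scale_right scale_sum_right sum_subtractf
          scale_right_diff_distrib mult_ac)
    then have "sum ?t {..<N} = phase P *s (\<Sum>s<N. \<Sum>i<M. h i s)"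
      by (simp only: scale_sum_right)
    moreover have "phase (Q + P - 2 * n - 2) = phase (Q - 2 * n - 2) * phase P"
      unfolding phase_add[symmetric] by (simp add: algebra_simps)
    ultimately show "adj_mode (mode a n v) k w = phase (Q - 2 * n - 2) *s sum ?t {..<N}"
      using adj_mode_wt_space[OF mode_wt_space[OF a v] J, of k w] lhs sums by simp
  qed
qed

section \<open>The invariant form\<close>

lemma generator_quasi_primary: "a \<in> W Q \<Longrightarrow> Q = 3 \<or> Q = 4 \<Longrightarrow> L 1 a = 0"
  by (rule wt_space_trivial[OF L1_wt_space[of a Q]]) auto

text \<open>
By weights, $a_m x$ has a vacuum component only if $x$ has weight $m + 1 - q \leq q - 1 \leq 1$. The
only such nonzero space is $V_{(0)}$, and there $m = q - 1 \geq 0$ and $a_m\mathbf 1 = 0$.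
\<close>
lemma vac_coeff_generator_mode:
  assumes a: "a \<in> W Q" "Q = 3 \<or> Q = 4" and m: "m \<le> Q - 2"
  shows "vac_coeff (mode a m x) = 0"
proof (induction x rule: homogeneous_induct)
  case (homogeneous X x)
  show ?case
  proof (cases "Q + X - 2 * m - 2 = 0")
    case False
    then show ?thesis using mode_wt_space[OF a(1) homogeneous] vac_coeff_wt_space by blast
  next
    case True
    show ?thesis
    proof (cases "X = 0")
      case X: True
      then have "x = vac_coeff x *s vac" using wt_space_0 homogeneous by simp
      moreover have "mode a m vac = 0" using True X a(2) by (intro vac_right_nonneg) auto
      ultimately show ?thesis by (metis mode_scale_right scale_zero_right vac_coeff_zero)
    next
      case False
      then have "x = 0" using True m a(2) by (intro wt_space_trivial[OF homogeneous]) auto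
      then show ?thesis by simp
    qed
  qed
next
  case (add x y)
  then show ?case by (simp add: mode_add_right vac_coeff_add)
qed

lemma vac_coeff_minus: "vac_coeff (- x) = - vac_coeff x"
  using vac_coeff_scale[of "- 1" x] by simp

lemma vac_coeff_diff: "vac_coeff (x - y) = vac_coeff x - vac_coeff y"
  using vac_coeff_add[of x "(- 1) *s y"] vac_coeff_scale[of "- 1" y] by simp

lemma L1_vac: "L 1 vac = 0"
  by (simp add: L_def vac_right_nonneg)

lemma adj_mode_vac: "adj_mode vac n w = (if n = - 1 then w else 0)"
  using adj_mode_quasi_primary[OF vac_wt_space L1_vac, of n w] by (auto simp: vac_left)

text \<open>
The dual of $v_r\mathbf 1 = 0$. In \<open>adj_mode_mode\<close> the first family of summands starts with a mode
$a_{2q-2-s}$ of a generator, handled by \<open>vac_coeff_generator_mode\<close>, and the second one with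
$v^\dagger_{r+s}$, handled by induction.
\<close>
lemma vac_coeff_adj_mode_nonneg: "r \<ge> 0 \<Longrightarrow> vac_coeff (adj_mode v r w) = 0"
proof -
  have "\<forall>r\<ge>0. \<forall>w. vac_coeff (adj_mode v r w) = 0"
  proof (induction v rule: monomial_induct)
    case (monomial v P)
    then show ?case
    proof (induction rule: monomial.induct)
      case vac
      show ?case by (simp add: adj_mode_vac)
    next
      case (mode v P a Q n)
      note a = mode(2,3)
      show ?case
      proof (intro allI impI)
        fix r :: int and w assume r: "r \<ge> 0"
        from eventually_happens'[OF _ adj_mode_mode[OF a(1) generator_quasi_primary[OF a]
              monomial_wt_space[OF mode(1)], of "- n" r w]]
        obtain N where N: "adj_mode (mode a (- n) v) r w = phase (Q - 2 * - n - 2) *s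
          (\<Sum>s<N. ((- 1) ^ s * (of_int (- n) gchoose s)) *s
            (mode a (Q - 2 - int s) (adj_mode v (- n + r - int s) w)
             - (koszul_sign Q P * (- 1) powi - n) *s
                 adj_mode v (r + int s) (mode a (Q - 2 - - n + int s) w)))"
          by auto
        show "vac_coeff (adj_mode (mode a (- n) v) r w) = 0"
          unfolding N using mode.IH r
          by (simp add: vac_coeff_scale vac_coeff_sum vac_coeff_diff vac_coeff_generator_mode[OF a])
      qed
    qed
  qed (simp_all add: adj_mode_add_left adj_mode_scale_left vac_coeff_add vac_coeff_scale)
  then show "r \<ge> 0 \<Longrightarrow> vac_coeff (adj_mode v r w) = 0" by blast
qed

definition form :: "'v \<Rightarrow> 'v \<Rightarrow> complex" where
  "form v w = vac_coeff (adj_mode v (- 1) w)"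

lemma form_add_left: "form (u + v) w = form u w + form v w"
  and form_add_right: "form w (u + v) = form w u + form w v"
  and form_scale_left: "form (c *s v) w = c * form v w"
  and form_scale_right: "form w (c *s v) = c * form w v"
  by (simp_all add: form_def adj_mode_add_left adj_mode_add_right adj_mode_scale_left
      adj_mode_scale_right vac_coeff_add vac_coeff_scale)

lemma form_zero [simp]: "form 0 w = 0" "form w 0 = 0"
  by (simp_all add: form_def)

lemma form_diff_left: "form (u - v) w = form u w - form v w"
  and form_diff_right: "form w (u - v) = form w u - form w v"
  using form_add_left[of u "(- 1) *s v" w] form_add_right[of w u "(- 1) *s v"]
    form_scale_left[of "- 1" v w] form_scale_right[of w "- 1" v] by simp_all

lemma form_sum_left: "form (sum f A) w = (\<Sum>i\<in>A. form (f i) w)"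
  by (induction A rule: infinite_finite_induct) (auto simp: form_add_left)

lemma form_sum_right: "form w (sum f A) = (\<Sum>i\<in>A. form w (f i))"
  by (induction A rule: infinite_finite_induct) (auto simp: form_add_right)

lemma form_vac_left: "form vac w = vac_coeff w"
  by (simp add: form_def adj_mode_vac)

text \<open>
Among the summands of \<open>adj_mode_mode\<close> at $k = -1$ only one is not killed by \<open>vac_coeff\<close>: the term
$v^\dagger_{-1} a_{2q-2-n} w$ at $s = 0$.
\<close>
lemma form_generator_mode:
  assumes a: "a \<in> W Q" "Q = 3 \<or> Q = 4" and v: "v \<in> W P"
  shows "form (mode a n v) w = koszul_sign Q P * phase Q * form v (mode a (Q - 2 - n) w)"
proof -
  from eventually_happens'[OF _ eventually_conj[OF eventually_ge_at_top[of 1]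
      adj_mode_mode[OF a(1) generator_quasi_primary[OF a] v, of n "- 1" w]]]
  obtain N where N: "N \<ge> 1" "adj_mode (mode a n v) (- 1) w = phase (Q - 2 * n - 2) *s
    (\<Sum>s<N. ((- 1) ^ s * (of_int n gchoose s)) *s
      (mode a (Q - 2 - int s) (adj_mode v (n + - 1 - int s) w)
       - (koszul_sign Q P * (- 1) powi n) *s
           adj_mode v (- 1 + int s) (mode a (Q - 2 - n + int s) w)))"
    by auto
  obtain N' where N': "N = Suc N'" using N(1) by (cases N) auto
  have "form (mode a n v) w
      = phase (Q - 2 * n - 2) * - (koszul_sign Q P * (- 1) powi n * form v (mode a (Q - 2 - n) w))"
    unfolding form_def N(2) N' sum.lessThan_Suc_shift
    by (simp add: vac_coeff_scale vac_coeff_add vac_coeff_sum vac_coeff_diff vac_coeff_minus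
        vac_coeff_generator_mode[OF a] vac_coeff_adj_mode_nonneg)
  also have "\<dots> = koszul_sign Q P * phase Q * form v (mode a (Q - 2 - n) w)
      * ((- 1) powi n * (- 1) powi n)"
    by (simp add: phase_shift)
  finally show ?thesis by simp
qed

definition adjoint_pair :: "'v \<Rightarrow> int \<Rightarrow> bool" where
  "adjoint_pair u P \<longleftrightarrow> (\<forall>X x n w. x \<in> W X \<longrightarrow>
     form (mode u n x) w = koszul_sign P X * form x (adj_mode u n w))"

text \<open>
Both $(a_n v)_k$ and $(a_n v)^\dagger_k$ are sums over $s$ of products of two modes, with the same
binomial coefficients. Taking adjoints of the two factors exchanges the two families of products:
the family with $a$ on the left becomes the one with $v^\dagger$ on the left, and conversely.
\<close>
lemma adjoint_pair_generator_mode: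
  assumes a: "a \<in> W Q" "Q = 3 \<or> Q = 4" and v: "v \<in> W P" and adj: "adjoint_pair v P"
  shows "adjoint_pair (mode a n v) (Q + P - 2 * n - 2)"
  unfolding adjoint_pair_def
proof (intro allI impI)
  fix X x k w assume x: "x \<in> W X"
  let ?R = "Q + P - 2 * n - 2"
  note ga = form_generator_mode[OF a]
  from eventually_happens'[OF _ eventually_conj[OF
      adj_mode_mode[OF a(1) generator_quasi_primary[OF a] v, of n k w]
      mode_mode_associator[OF a(1) v, of n k x]]]
  obtain N where N: "adj_mode (mode a n v) k w = phase (Q - 2 * n - 2) *s
    (\<Sum>s<N. ((- 1) ^ s * (of_int n gchoose s)) *s
      (mode a (Q - 2 - int s) (adj_mode v (n + k - int s) w)
       - (koszul_sign Q P * (- 1) powi n) *s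
           adj_mode v (k + int s) (mode a (Q - 2 - n + int s) w)))"
    "mode (mode a n v) k x =
    (\<Sum>s<N. ((- 1) ^ s * (of_int n gchoose s)) *s
      (mode a (n - int s) (mode v (k + int s) x)
       - (koszul_sign Q P * (- 1) powi n) *s mode v (n + k - int s) (mode a (int s) x)))"
    by auto
  have summand: "form (mode a (n - int s) (mode v (k + int s) x)
       - (koszul_sign Q P * (- 1) powi n) *s mode v (n + k - int s) (mode a (int s) x)) w
    = koszul_sign ?R X * phase (Q - 2 * n - 2) *
      form x (mode a (Q - 2 - int s) (adj_mode v (n + k - int s) w)
       - (koszul_sign Q P * (- 1) powi n) *s
           adj_mode v (k + int s) (mode a (Q - 2 - n + int s) w))" for s
  proof -
    define \<alpha> where "\<alpha> = form x (mode a (Q - 2 - int s) (adj_mode v (n + k - int s) w))"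
    define \<beta> where "\<beta> = form x (adj_mode v (k + int s) (mode a (Q - 2 - n + int s) w))"
    have idx: "Q - 2 - (n - int s) = Q - 2 - n + int s" by simp
    have 1: "form (mode a (n - int s) (mode v (k + int s) x)) w
        = koszul_sign Q P * koszul_sign Q X * koszul_sign P X * phase Q * \<beta>"
      unfolding ga[OF mode_wt_space[OF v x]] idx \<beta>_def koszul_sign_mode
        adj[unfolded adjoint_pair_def, rule_format, OF x]
      by (simp only: mult_ac)
    have 2: "form (mode v (n + k - int s) (mode a (int s) x)) w
        = koszul_sign Q P * koszul_sign Q X * koszul_sign P X * phase Q * \<alpha>"
      using adj[unfolded adjoint_pair_def, rule_format, OF mode_wt_space[OF a(1) x]]
      by (simp add: koszul_sign_mode ga[OF x] \<alpha>_def koszul_sign_commute[of P Q])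
    \<comment> \<open>The roles of \<alpha> and \<beta> are exchanged; the factor between them is made up by
      the phase, see phase_shift.\<close>
    show ?thesis
      unfolding form_diff_left form_diff_right form_scale_left form_scale_right 1 2
        \<alpha>_def[symmetric] \<beta>_def[symmetric] koszul_sign_mode phase_shift
      by (auto simp: koszul_sign_def power_int_minus_left algebra_simps)
  qed
  show "form (mode (mode a n v) k x) w = koszul_sign ?R X * form x (adj_mode (mode a n v) k w)"
    unfolding N form_sum_left form_sum_right form_scale_left form_scale_right summand
    by (simp add: sum_distrib_left mult_ac)
qed

lemma adjoint_pair_monomial: "monomial u P \<Longrightarrow> adjoint_pair u P"
proof (induction rule: monomial.induct)
  case vac
  show ?case by (auto simp: adjoint_pair_def adj_mode_vac vac_left koszul_sign_def)
next
  case (mode v P a Q n)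
  then show ?case
    using adjoint_pair_generator_mode[OF mode(2,3) monomial_wt_space[OF mode(1)], of "- n"] by simp
qed

lemma adjoint_pair_wt_space:
  assumes u: "u \<in> W P"
  shows "adjoint_pair u P"
proof -
  have "adjoint_pair (wt_component (of_int P / 2) u) P"
  proof (induction u rule: monomial_induct)
    case (monomial u R)
    then show ?case
      using wt_component_wt_space[OF monomial_wt_space, of u R] adjoint_pair_monomial[of u R]
      by (cases "P = R") (auto simp: adjoint_pair_def)
  qed (simp_all add: adjoint_pair_def wt_component_add wt_component_scale mode_add_left
      mode_scale_left adj_mode_add_left adj_mode_scale_left form_add_left form_add_right
      form_scale_left form_scale_right ring_distribs)
  then show ?thesis using wt_component_wt_space[OF u] by simp
qed

lemma form_mode:
  assumes "u \<in> W P" "v \<in> W Q"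
  shows "form (mode u n v) w = koszul_sign P Q * form v (adj_mode u n w)"
  using adjoint_pair_wt_space[OF assms(1)] assms(2) by (simp add: adjoint_pair_def)

lemma form_L0: "form (L 0 v) w = form v (L 0 w)"
proof (induction v rule: homogeneous_induct)
  case (homogeneous P v)
  then show ?case
    using form_generator_mode[OF om_wt_space _ homogeneous, of 1 w]
    by (simp add: L_def koszul_sign_def phase_4)
qed (simp add: L_add form_add_left)

lemma form_orthogonal:
  assumes "v \<in> W P" "w \<in> W Q" "P \<noteq> Q"
  shows "form v w = 0"
  using form_L0[of v w] assms(3)
  by (simp add: L0_wt_space[OF assms(1)] L0_wt_space[OF assms(2)] form_scale_left form_scale_right)

text \<open>
A generator is moved from the left to the right argument, the induction hypothesis is applied, and
the generator is moved back. If the weights of the arguments differ, both sides vanish; if they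
agree, the signs combine with \<open>phase_double\<close> to $1$.
\<close>
lemma form_symmetric: "form v w = form w v"
proof -
  have homogeneous: "form v w = form w v" if "monomial v P" "w \<in> W R" for v w P R
    using that
  proof (induction arbitrary: w R rule: monomial.induct)
    case vac
    show ?case
    proof (cases "R = 0")
      case True
      then obtain c where "w = c *s vac" using wt_space_0 vac by blast
      then show ?thesis by (simp add: form_scale_left form_scale_right)
    next
      case False
      then show ?thesis
        using form_orthogonal[OF vac_wt_space vac] form_orthogonal[OF vac vac_wt_space] by simp
    qed
  next
    case (mode v P a Q n)
    note v = monomial_wt_space[OF mode(1)]
    note av = monomial_wt_space[OF monomial.mode[OF mode(1-4)]]
    show ?case
    proof (cases "R = Q + P + 2 * n - 2")
      case True
      have sign: "koszul_sign Q P * koszul_sign Q R * (phase Q * phase Q) = 1"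
        unfolding phase_double by (auto simp: True koszul_sign_def)
      have "form (mode a (- n) v) w = koszul_sign Q P * phase Q * form v (mode a (Q - 2 + n) w)"
        using form_generator_mode[OF mode(2,3) v, of "- n" w] by simp
      also have "form v (mode a (Q - 2 + n) w) = form (mode a (Q - 2 + n) w) v"
        by (rule mode.IH[OF mode_wt_space[OF mode(2) mode.prems]])
      also have "\<dots> = koszul_sign Q R * phase Q * form w (mode a (- n) v)"
        using form_generator_mode[OF mode(2,3) mode.prems, of "Q - 2 + n" v] by simp
      finally show ?thesis
        using sign by (simp add: mult_ac)
    next
      case False
      then show ?thesis
        using form_orthogonal[OF av mode.prems] form_orthogonal[OF mode.prems av] by auto
    qed
  qed
  have "form v w = form w v" if "w \<in> W R" for w R v
    by (induction v rule: monomial_induct)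
      (simp_all add: form_add_left form_add_right form_scale_left form_scale_right homogeneous[OF _ that])
  then show ?thesis
    by (induction w rule: homogeneous_induct) (simp_all add: form_add_left form_add_right)
qed

section \<open>Existence and uniqueness\<close>

lemma invariant_form_form: "invariant_form form"
  unfolding invariant_form_def
proof (intro allI impI)
  fix a b u v w n
  assume u: "u \<in> parity_space a" and v: "v \<in> parity_space b"
  show "form (mode u n v) w = (- 1) ^ (a * b) * form v (adj_mode u n w)"
    using u
  proof (induction u rule: parity_space_induct)
    case u: (homogeneous k u)
    show ?case
      using v
    proof (induction v rule: parity_space_induct)
      case v: (homogeneous l v)
      show ?case
        using form_mode[OF u v] by (simp add: koszul_sign_power[of a b k l])
    qed (simp_all add: mode_add_right form_add_left ring_distribs)
  qed (simp_all add: mode_add_left adj_mode_add_left form_add_left form_add_right ring_distribs)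
qed

lemma vector_space_complex: "vector_space ((*) :: complex \<Rightarrow> complex \<Rightarrow> complex)"
  by unfold_locales (simp_all add: algebra_simps)

lemma normalized_form_form: "normalized_form form"
  using invariant_form_form form_symmetric vector_space_axioms vector_space_complex
  by (auto simp: normalized_form_def bilinear_form_def symmetric_form_def Vector_Spaces.linear_iff
      form_add_left form_add_right form_scale_left form_scale_right form_vac_left)

text \<open>
As $v = v_{-1}\mathbf 1$, invariance moves all of $v$ into the right argument, and only the functional
$\langle\mathbf 1,\cdot\rangle$ remains to be determined. Since $L(0)$ is self-adjoint and
$L(0)\mathbf 1 = 0$, this functional is supported on $V_{(0)} = \mathbb{C}\mathbf 1$.
\<close>
lemma normalized_form_eq:
  assumes "normalized_form B"
  shows "B = form"
proof -
  have bilinear: "B (x + y) z = B x z + B y z" "B z (x + y) = B z x + B z y"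
    "B (c *s x) z = c * B x z" "B z (c *s x) = c * B z x" for x y z c
    using assms by (simp_all add: normalized_form_def bilinear_form_def Vector_Spaces.linear_iff)
  have B_vac: "B vac vac = 1" using assms by (simp add: normalized_form_def)
  have adjoint: "B (mode u n vac) w = B vac (adj_mode u n w)" if u: "u \<in> W P" for u P n w
    using assms wt_space_parity_mod[OF u] vac_even
    by (force simp: normalized_form_def invariant_form_def)
  have L0: "B (L 0 vac) w = B vac (L 0 w)" for w
    using adjoint[OF om_wt_space, of 1 w]
      adj_mode_quasi_primary[OF om_wt_space generator_quasi_primary[OF om_wt_space], of 1 w]
    by (simp add: L_def phase_4)
  have B_vac_left: "B vac w = vac_coeff w" for w
  proof (induction w rule: homogeneous_induct)
    case (homogeneous R w)
    show ?case
    proof (cases "R = 0")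
      case True
      then obtain c where "w = c *s vac" using wt_space_0 homogeneous by blast
      then show ?thesis by (simp add: bilinear B_vac vac_coeff_scale)
    next
      case False
      have "L 0 vac = 0 *s vac" using L0_wt_space[OF vac_wt_space] by simp
      then have "of_int R / 2 * B vac w = 0 * B vac w"
        using L0[of w] bilinear(3)[of 0 vac w] by (simp add: L0_wt_space[OF homogeneous] bilinear)
      then show ?thesis using False vac_coeff_wt_space[OF homogeneous] by simp
    qed
  qed (simp add: bilinear vac_coeff_add)
  have "B v w = form v w" for v w
  proof (induction v rule: homogeneous_induct)
    case (homogeneous P v)
    then show ?case
      using adjoint[OF homogeneous, of "- 1" w] by (simp add: vac_right B_vac_left form_def)
  qed (simp add: bilinear form_add_left)
  then show ?thesis by blast
qed

section \<open>The kernel and the maximal ideal\<close>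

lemma subspace_form_kernel: "subspace (form_kernel form)"
  by (auto simp: subspace_def form_kernel_def form_add_left form_scale_left)

text \<open>
The sign in the invariance condition depends on the parities, so the argument works on homogeneous
vectors; the kernel is graded because $L(0)$ is self-adjoint.
\<close>
lemma is_ideal_form_kernel: "is_ideal (form_kernel form)"
proof (rule left_ideal_is_ideal[OF subspace_form_kernel])
  fix x v n
  assume x: "x \<in> form_kernel form"
  note sub = subspace_form_kernel
  have L0: "L 0 y \<in> form_kernel form" if "y \<in> form_kernel form" for y
    using that by (simp add: form_kernel_def form_L0)
  show "mode v n x \<in> form_kernel form"
  proof (induction v rule: homogeneous_induct)
    case v: (homogeneous P v)
    have "mode v n (wt_component q x) \<in> form_kernel form" for q
    proof (cases q x rule: wt_component_cases)
      case 1
      then show ?thesis by (simp add: subspace_0[OF sub])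
    next
      case R: (2 R)
      have "wt_component q x \<in> form_kernel form"
        by (rule wt_components_in_invariant_subspace[OF sub L0 x])
      then show ?thesis
        unfolding R using form_mode[OF v wt_component_in] by (simp add: form_kernel_def)
    qed
    then have "(\<Sum>q | wt_component q x \<noteq> 0. mode v n (wt_component q x)) \<in> form_kernel form"
      by (intro subspace_sum[OF sub])
    then show ?case by (simp flip: mode_sum_right sum_wt_components)
  qed (simp add: mode_add_left subspace_add[OF sub])
qed

lemma vac_notin_form_kernel: "vac \<notin> form_kernel form"
  by (auto simp: form_kernel_def form_vac_left intro!: exI[of _ vac])

text \<open>
An ideal contains the weight-$0$ component of each of its elements, a multiple of $\mathbf 1$, and an
ideal containing $\mathbf 1$ is everything. So \<open>vac_coeff\<close> vanishes on a proper ideal, and with it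
$\langle w, x\rangle$, since adjoint modes are finite sums of modes.
\<close>
lemma proper_ideal_subset_form_kernel:
  assumes J: "is_ideal J" "J \<noteq> UNIV"
  shows "J \<subseteq> form_kernel form"
proof -
  have sub: "subspace J" and closed: "\<And>x v n. x \<in> J \<Longrightarrow> mode v n x \<in> J \<and> mode x n v \<in> J"
    using J by (auto simp: is_ideal_def)
  have vac: "vac \<notin> J"
  proof
    assume "vac \<in> J"
    then have "v \<in> J" for v using closed[of vac v "- 1"] by (simp add: vac_right)
    with J(2) show False by blast
  qed
  have coeff: "vac_coeff x = 0" if "x \<in> J" for x
  proof (rule ccontr)
    assume "vac_coeff x \<noteq> 0"
    then have "vac = (1 / vac_coeff x) *s wt_component 0 x" by (simp add: wt_component_0)
    moreover have "wt_component 0 x \<in> J"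
      by (rule wt_components_in_invariant_subspace[OF sub _ that]) (simp add: L_def closed)
    ultimately have "vac \<in> J" using subspace_scale[OF sub] by metis
    with vac show False ..
  qed
  have adj: "adj_mode w n x \<in> J" if "x \<in> J" for w n x
    unfolding adj_mode_eq_sum[OF finite_adj_coeff subset_refl]
    using closed that by (intro subspace_sum[OF sub]) auto
  show ?thesis
  proof
    fix x assume "x \<in> J"
    then have "form w x = 0" for w using coeff adj by (simp add: form_def)
    then show "x \<in> form_kernel form" by (simp add: form_kernel_def form_symmetric[of x])
  qed
qed

lemma maximal_ideal_iff: "is_maximal_ideal I \<longleftrightarrow> I = form_kernel form"
proof -
  have "form_kernel form \<noteq> UNIV" using vac_notin_form_kernel by blast
  then show ?thesis
    unfolding is_maximal_ideal_def
    using is_ideal_form_kernel proper_ideal_subset_form_kernel by blast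
qed

lemma simple_iff_nondegenerate: "is_simple \<longleftrightarrow> nondegenerate_form form"
proof
  assume is_simple
  then show "nondegenerate_form form"
    using is_ideal_form_kernel vac_notin_form_kernel
    unfolding is_simple_def nondegenerate_form_def by blast
next
  assume nd: "nondegenerate_form form"
  show is_simple
    unfolding is_simple_def
  proof (intro allI impI)
    fix I assume I: "is_ideal I"
    then have "0 \<in> I" by (simp add: is_ideal_def subspace_0)
    then show "I = {0} \<or> I = UNIV"
      using proper_ideal_subset_form_kernel[OF I] nd by (auto simp: nondegenerate_form_def)
  qed
qed

end

theorem proposition3p20:
  fixes scale :: "complex \<Rightarrow> 'v::ab_group_add \<Rightarrow> 'v"
    and mode :: "'v \<Rightarrow> int \<Rightarrow> 'v \<Rightarrow> 'v"
    and vac om :: 'v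
  assumes "vertex_operator_superalgebra scale mode vac om"
    and "(UNIV :: 'v set) \<noteq> {0}"
    and "vosa_data.strongly_generated_by scale mode vac
           {x + y | x y. x \<in> vosa_data.wt_space scale mode om (3 / 2) \<and>
                         y \<in> vosa_data.wt_space scale mode om 2}"
  shows "(\<exists>!B. vosa_data.normalized_form scale mode vac om B) \<and>
         (\<exists>!I. vosa_data.is_maximal_ideal scale mode I) \<and>
         (\<forall>B. vosa_data.normalized_form scale mode vac om B \<longrightarrow>
            (\<forall>I. vosa_data.is_maximal_ideal scale mode I \<longrightarrow>
               vosa_data.form_kernel B = I \<and> vac \<notin> I) \<and>
            (vosa_data.is_simple scale mode \<longleftrightarrow> vosa_data.nondegenerate_form B))"
proof -
  interpret V: vosa_generated_in_low_weight scale mode vac om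
    using assms by (simp add: vosa_generated_in_low_weight_def vosa_generated_in_low_weight_axioms_def)
  have normalized: "V.normalized_form B \<longleftrightarrow> B = V.form" for B
    using V.normalized_form_form V.normalized_form_eq by blast
  show ?thesis
    by (simp add: normalized V.maximal_ideal_iff V.vac_notin_form_kernel V.simple_iff_nondegenerate)
qed

end
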